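(* Let $\rho\in(0,1)$ and let $\mathrm{Path}_k$ be the path graph of length $k\ge1$ with vertices $v_0,v_1,\dots,v_k$ (consecutive vertices adjacent). (1) Let $S\subseteq\{v_0,\dots,v_k\}$ have size at least two. Then for every $n\ge1$ the simple dictator protocols are the unique optimal protocols: a protocol $(f_v)_{v\in S}$ satisfies $\mathcal{P}(\mathrm{Path}_k,\rho,n,S,(f_v))=\mathcal{M}(\mathrm{Path}_k,\rho,n,S)$ if and only if all the $f_v$ are equal to one and the same dictator function. In particular, if $S=\{v_{i_0},\dots,v_{i_\ell}\}$ where $i_0<i_1<\cdots<i_\ell$, then $$\mathcal{M}(\mathrm{Path}_k,\rho,S)=\prod_{j=1}^{\ell}\left(\frac12+\frac12\rho^{\,i_j-i_{j-1}}\right).$$ (2) Moreover, for every $\rho\in(0,1)$ and $n\ge1$ there exists $c=c(\rho,n)<1$ such that for every $k\ge 1$, if $S=\{v_0,\dots,v_k\}$ is the full vertex set of $\mathrm{Path}_k$, then for any simple protocol given by a balanced function $f:\{-1,1\}^n\to\{-1,1\}$ which is not a dictator, $$\mathcal{P}(\mathrm{Path}_k,\rho,n,S,f)\le\mathcal{P}(\mathrm{Path}_k,\rho,n,S,\mathcal{D})\,c^{|S|-1},$$ where $\mathcal{D}$ denotes the dictator function.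
   Context: NICD on trees. An instance consists of a finite undirected tree $T$, a correlation parameter $\rho\in(0,1)$, an integer $n\ge1$ and a set of players $S\subseteq V(T)$. Random strings $x^{(v)}\in\{-1,1\}^n$, $v\in V(T)$, are generated as follows: the $n$ coordinates are independent, and for each coordinate $i$ the vector $\alpha=(x^{(v)}_i)_{v\in V(T)}\in\{-1,1\}^{V(T)}$ has probability $\mathbf{P}(\alpha)=\frac12(\frac12+\frac12\rho)^{A(\alpha)}(\frac12-\frac12\rho)^{B(\alpha)}$, where $A(\alpha)$, $B(\alpha)$ are the numbers of edges of $T$ whose endpoints agree, respectively disagree, in $\alpha$. A function $f:\{-1,1\}^n\to\{-1,1\}$ is balanced if it takes each value on exactly $2^{n-1}$ inputs. A protocol is a family $(f_v)_{v\in S}$ of balanced functions; it is simple if all $f_v$ are the same function. $\mathcal{P}(T,\rho,n,S,(f_v)_{v\in S})$ is the probability that all the bits $f_v(x^{(v)})$, $v\in S$, are equal; for a simple protocol with common function $f$ write $\mathcal{P}(T,\rho,n,S,f)$. Define $\mathcal{M}(T,\rho,n,S)=\sup_{(f_v)}\mathcal{P}(T,\rho,n,S,(f_v))$ over all protocols, and $\mathcal{M}(T,\rho,S)=\sup_{n}\mathcal{M}(T,\rho,n,S)$. A protocol is optimal for $(T,\rho,n,S)$ if it attains $\mathcal{M}(T,\rho,n,S)$. A dictator function is one of the functions $x\mapsto x_i$ or $x\mapsto -x_i$ for some $i\in\{1,\dots,n\}$; a simple dictator protocol is a simple protocol whose common function is a dictator. The success probability of a simple dictator protocol does not depend on which dictator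 is used; $\mathcal{D}$ can be taken to be $x\mapsto x_1$. *)

theory Defs
  imports "HOL-Probability.Probability"
begin

text \<open>
  A graph is given by its vertex set \<open>V\<close> and its set \<open>E\<close> of undirected edges, each edge being a
  two-element set of vertices. The definitions make sense for every finite graph; the weights of
  \<open>spin_weight\<close> add up to 1 when the graph is a tree.
\<close>

definition agree_edges :: "'v set set \<Rightarrow> ('v \<Rightarrow> int) \<Rightarrow> 'v set set" where
  "agree_edges E \<alpha> = {e \<in> E. \<forall>u\<in>e. \<forall>v\<in>e. \<alpha> u = \<alpha> v}"

definition disagree_edges :: "'v set set \<Rightarrow> ('v \<Rightarrow> int) \<Rightarrow> 'v set set" where
  "disagree_edges E \<alpha> = {e \<in> E. \<exists>u\<in>e. \<exists>v\<in>e. \<alpha> u \<noteq> \<alpha> v}"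

definition spin_weight :: "'v set set \<Rightarrow> real \<Rightarrow> ('v \<Rightarrow> int) \<Rightarrow> real" where
  "spin_weight E \<rho> \<alpha> =
     1/2 * (1/2 + 1/2 * \<rho>) ^ card (agree_edges E \<alpha>) * (1/2 - 1/2 * \<rho>) ^ card (disagree_edges E \<alpha>)"

definition spin_measure :: "'v set \<Rightarrow> 'v set set \<Rightarrow> real \<Rightarrow> ('v \<Rightarrow> int) measure" where
  "spin_measure V E \<rho> = point_measure (V \<rightarrow>\<^sub>E {-1, 1}) (\<lambda>\<alpha>. ennreal (spin_weight E \<rho> \<alpha>))"

text \<open>An outcome \<open>\<omega>\<close> is indexed by the coordinate first: \<open>\<omega> i v\<close> is the \<open>i\<close>-th bit of the string at \<open>v\<close>.\<close>

definition nicd_measure :: "'v set \<Rightarrow> 'v set set \<Rightarrow> real \<Rightarrow> nat \<Rightarrow> (nat \<Rightarrow> 'v \<Rightarrow> int) measure" where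
  "nicd_measure V E \<rho> n = (\<Pi>\<^sub>M i\<in>{1..n}. spin_measure V E \<rho>)"

definition player_string :: "nat \<Rightarrow> (nat \<Rightarrow> 'v \<Rightarrow> int) \<Rightarrow> 'v \<Rightarrow> nat \<Rightarrow> int" where
  "player_string n \<omega> v = (\<lambda>i\<in>{1..n}. \<omega> i v)"

definition cube :: "nat \<Rightarrow> (nat \<Rightarrow> int) set" where
  "cube n = {1..n} \<rightarrow>\<^sub>E {-1, 1}"

text \<open>
  Functions on the cube are represented by total functions whose values outside \<open>cube n\<close> are
  irrelevant; equality of such functions is always meant on \<open>cube n\<close>.
\<close>

definition balanced :: "nat \<Rightarrow> ((nat \<Rightarrow> int) \<Rightarrow> int) \<Rightarrow> bool" where
  "balanced n f \<longleftrightarrow> f \<in> cube n \<rightarrow> {-1, 1} \<and>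
     (\<forall>b\<in>{-1, 1}. card {x \<in> cube n. f x = b} = 2 ^ (n - 1))"

definition dictator :: "nat \<Rightarrow> ((nat \<Rightarrow> int) \<Rightarrow> int) \<Rightarrow> bool" where
  "dictator n f \<longleftrightarrow>
     (\<exists>i\<in>{1..n}. (\<forall>x\<in>cube n. f x = x i) \<or> (\<forall>x\<in>cube n. f x = - x i))"

definition protocol :: "nat \<Rightarrow> 'v set \<Rightarrow> ('v \<Rightarrow> (nat \<Rightarrow> int) \<Rightarrow> int) \<Rightarrow> bool" where
  "protocol n S f \<longleftrightarrow> (\<forall>v\<in>S. balanced n (f v))"

definition simple_dictator_protocol ::
    "nat \<Rightarrow> 'v set \<Rightarrow> ('v \<Rightarrow> (nat \<Rightarrow> int) \<Rightarrow> int) \<Rightarrow> bool" where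
  "simple_dictator_protocol n S f \<longleftrightarrow>
     (\<exists>d. dictator n d \<and> (\<forall>v\<in>S. \<forall>x\<in>cube n. f v x = d x))"

definition success_prob ::
    "'v set \<Rightarrow> 'v set set \<Rightarrow> real \<Rightarrow> nat \<Rightarrow> 'v set \<Rightarrow> ('v \<Rightarrow> (nat \<Rightarrow> int) \<Rightarrow> int) \<Rightarrow> real" where
  "success_prob V E \<rho> n S f =
     measure (nicd_measure V E \<rho> n)
       {\<omega> \<in> space (nicd_measure V E \<rho> n).
          \<forall>u\<in>S. \<forall>v\<in>S. f u (player_string n \<omega> u) = f v (player_string n \<omega> v)}"

definition max_success_n :: "'v set \<Rightarrow> 'v set set \<Rightarrow> real \<Rightarrow> nat \<Rightarrow> 'v set \<Rightarrow> real" where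
  "max_success_n V E \<rho> n S = (SUP f\<in>{f. protocol n S f}. success_prob V E \<rho> n S f)"

definition max_success :: "'v set \<Rightarrow> 'v set set \<Rightarrow> real \<Rightarrow> 'v set \<Rightarrow> real" where
  "max_success V E \<rho> S = (SUP n\<in>{1..}. max_success_n V E \<rho> n S)"

definition optimal_protocol ::
    "'v set \<Rightarrow> 'v set set \<Rightarrow> real \<Rightarrow> nat \<Rightarrow> 'v set \<Rightarrow> ('v \<Rightarrow> (nat \<Rightarrow> int) \<Rightarrow> int) \<Rightarrow> bool" where
  "optimal_protocol V E \<rho> n S f \<longleftrightarrow>
     protocol n S f \<and> success_prob V E \<rho> n S f = max_success_n V E \<rho> n S"

text \<open>The path of length \<open>k\<close> has the \<open>k + 1\<close> vertices \<open>0, \<dots>, k\<close>.\<close>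

definition path_verts :: "nat \<Rightarrow> nat set" where
  "path_verts k = {0..k}"

definition path_edges :: "nat \<Rightarrow> nat set set" where
  "path_edges k = {{i, Suc i} | i. i < k}"

end

theory Submission
  imports Defs
begin

text \<open>
  The strings at consecutive vertices form a reversible Markov chain on the cube, whose transition
  operator is the noise operator with parameter \<open>\<rho>\<close>. The characters diagonalise it, with eigenvalue
  \<open>\<rho> ^ card U\<close> at the character of \<open>U\<close>. Two players at distance \<open>d\<close> are linked by noise
  with parameter \<open>\<rho> ^ d\<close>. The probability that all players announce the bit \<open>b\<close> is therefore computed
  by starting with the indicator of the level set of the first player and, for each further player,
  applying noise and restricting to the level set of that player (lemmas \<open>success_prob_path\<close> and
  \<open>avg_weighted_walk\<close>). Balancedness says that all level sets contain half of the cube.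

  The heart of the matter is one restricted step. Let \<open>g\<close> be supported on a half set \<open>A\<close>. Its mean has
  square at most \<open>1/2\<close> times its squared norm, and every Fourier coefficient apart from the mean is
  multiplied by at most \<open>r\<close>. So the quadratic form of the noise operator at \<open>g\<close> is at most
  \<open>(1 - r) / 2 + r = (1 + r) / 2\<close> times the squared norm. Lemma \<open>noise_form_gap\<close> refines this by
  subtracting a multiple of the \<open>excess\<close> of the indicator of \<open>A\<close>, a weighted sum of its squared Fourier
  coefficients of degree at least two. The excess vanishes only for dictators, and the coefficients are
  integers divided by \<open>2 ^ n\<close>, so the excess of any other half set is bounded below in terms of \<open>r\<close>
  and \<open>n\<close> (lemma \<open>excess_lower_bound\<close>).

  By positivity of the form and Cauchy-Schwarz, each step multiplies the norm by at most
  \<open>(1 + r) / 2\<close>, and iterating yields the product formula as an upper bound, which dictators attain.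
  Equality must hold already in the first step, which starts from an indicator; there it forces the two
  level sets to be the same dictator set (lemma \<open>restricted_step_extremal\<close>). The step then reproduces
  the indicator up to a scalar, and the argument continues with the next player. For a simple protocol
  that is not a dictator, the uniform gap improves every step by the same factor, which gives the
  exponential decay.
\<close>

section \<open>Fourier analysis of the noise operator on the cube\<close>

definition avg :: "nat \<Rightarrow> ((nat \<Rightarrow> int) \<Rightarrow> real) \<Rightarrow> real" where
  "avg n f = (\<Sum>x\<in>cube n. f x) / 2 ^ n"

definition ip :: "nat \<Rightarrow> ((nat \<Rightarrow> int) \<Rightarrow> real) \<Rightarrow> ((nat \<Rightarrow> int) \<Rightarrow> real) \<Rightarrow> real" where
  "ip n f g = avg n (\<lambda>x. f x * g x)"

definition chi :: "nat set \<Rightarrow> (nat \<Rightarrow> int) \<Rightarrow> real" where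
  "chi U x = (\<Prod>i\<in>U. of_int (x i))"

definition fourier :: "nat \<Rightarrow> ((nat \<Rightarrow> int) \<Rightarrow> real) \<Rightarrow> nat set \<Rightarrow> real" where
  "fourier n f U = ip n f (chi U)"

text \<open>
  The kernel is the density, with respect to the uniform distribution, of a string \<open>y\<close> obtained from
  \<open>x\<close> by resampling every bit independently with correlation \<open>r\<close>. Hence \<open>noise n r f x\<close> is the
  conditional expectation of \<open>f y\<close> given \<open>x\<close>.
\<close>
definition noise_kernel :: "nat \<Rightarrow> real \<Rightarrow> (nat \<Rightarrow> int) \<Rightarrow> (nat \<Rightarrow> int) \<Rightarrow> real" where
  "noise_kernel n r x y = (\<Prod>i\<in>{1..n}. 1 + r * (of_int (x i) * of_int (y i)))"

definition noise :: "nat \<Rightarrow> real \<Rightarrow> ((nat \<Rightarrow> int) \<Rightarrow> real) \<Rightarrow> (nat \<Rightarrow> int) \<Rightarrow> real" where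
  "noise n r f x = avg n (\<lambda>y. noise_kernel n r x y * f y)"

lemma finite_cube [simp, intro]: "finite (cube n)"
  by (auto simp: cube_def intro: finite_PiE)

lemma card_cube: "card (cube n) = 2 ^ n"
  by (simp add: cube_def card_PiE numeral_2_eq_2)

lemma cube_bit: "x \<in> cube n \<Longrightarrow> i \<in> {1..n} \<Longrightarrow> x i = -1 \<or> x i = 1"
  by (auto simp: cube_def PiE_def Pi_def)

lemma avg_prod:
  "avg n (\<lambda>x. \<Prod>i\<in>{1..n}. q i (x i)) = (\<Prod>i\<in>{1..n}. (q i (-1) + q i 1) / 2)"
  unfolding avg_def cube_def
  by (subst prod_sum_PiE[symmetric]) (auto simp: prod_dividef)

lemma avg_sum: "avg n (\<lambda>x. \<Sum>a\<in>A. f a x) = (\<Sum>a\<in>A. avg n (f a))"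
  by (simp add: avg_def sum.swap[of _ A] sum_divide_distrib)

lemma avg_cmult: "avg n (\<lambda>x. c * f x) = c * avg n f"
  by (simp add: avg_def sum_distrib_left)

lemma avg_cong: "(\<And>x. x \<in> cube n \<Longrightarrow> f x = g x) \<Longrightarrow> avg n f = avg n g"
  by (simp add: avg_def)

lemma chi_empty [simp]: "chi {} x = 1"
  by (simp add: chi_def)

text \<open>
  Multiplying out the product over the coordinates is all the Fourier analysis that is needed: at
  \<open>r = 1\<close> this identity is the completeness of the characters, and for general \<open>r\<close> it says
  that noise multiplies the coefficient at \<open>U\<close> by \<open>r ^ card U\<close>.
\<close>
lemma noise_kernel_expansion:
  "noise_kernel n r x y = (\<Sum>U\<in>Pow {1..n}. r ^ card U * (chi U x * chi U y))"
  unfolding noise_kernel_def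
  by (subst add.commute, subst prod_add) (simp_all add: chi_def prod.distrib)

lemma noise_kernel_commute: "noise_kernel n r x y = noise_kernel n r y x"
  by (simp add: noise_kernel_def mult.commute)

lemma noise_kernel_1:
  assumes "x \<in> cube n" "y \<in> cube n"
  shows "noise_kernel n 1 x y = (if x = y then 2 ^ n else 0)"
proof (cases "x = y")
  case True
  have "1 + real_of_int (x i) * real_of_int (y i) = 2" if "i \<in> {1..n}" for i
    using cube_bit[OF assms(1) that] True by auto
  then show ?thesis
    using True by (simp add: noise_kernel_def)
next
  case False
  then obtain i where i: "i \<in> {1..n}" "x i \<noteq> y i"
    using assms unfolding cube_def by (meson PiE_ext)
  have "1 + real_of_int (x i) * real_of_int (y i) = 0"
    using cube_bit[OF assms(1) i(1)] cube_bit[OF assms(2) i(1)] i(2) by auto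
  then have "\<exists>i\<in>{1..n}. 1 + 1 * (real_of_int (x i) * real_of_int (y i)) = 0"
    using i by auto
  then show ?thesis
    using False by (simp add: noise_kernel_def)
qed

lemma noise_expansion:
  "noise n r f x = (\<Sum>U\<in>Pow {1..n}. r ^ card U * fourier n f U * chi U x)"
  unfolding noise_def noise_kernel_expansion sum_distrib_right avg_sum
  by (intro sum.cong refl)
    (simp add: fourier_def ip_def avg_def sum_distrib_left sum_distrib_right mult_ac
      sum_divide_distrib)

lemma noise_1: "x \<in> cube n \<Longrightarrow> noise n 1 f x = f x"
  by (simp add: noise_def avg_def noise_kernel_1 if_distrib[of "\<lambda>z. z * _"] cong: if_cong)

lemma fourier_inversion:
  "x \<in> cube n \<Longrightarrow> f x = (\<Sum>U\<in>Pow {1..n}. fourier n f U * chi U x)"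
  using noise_expansion[of n 1 f x] noise_1[of x n f] by simp

lemma ip_noise:
  "ip n f (noise n r g) = (\<Sum>U\<in>Pow {1..n}. r ^ card U * fourier n f U * fourier n g U)"
  unfolding ip_def noise_expansion sum_distrib_left avg_sum
  by (intro sum.cong refl)
    (simp add: fourier_def ip_def avg_def sum_distrib_left sum_distrib_right mult_ac
      sum_divide_distrib)

lemma ip_noise_commute: "ip n f (noise n r g) = ip n (noise n r f) g"
proof -
  have "ip n f (noise n r g) = ip n g (noise n r f)"
    by (simp add: ip_noise mult_ac)
  then show ?thesis
    by (simp add: ip_def mult.commute)
qed

lemma ip_noise_1: "ip n f (noise n 1 g) = ip n f g"
  by (simp add: ip_def noise_1 cong: avg_cong)

lemma parseval: "ip n f g = (\<Sum>U\<in>Pow {1..n}. fourier n f U * fourier n g U)"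
  using ip_noise[of n f 1 g] by (simp add: ip_noise_1)

lemma noise_chi:
  assumes "U \<subseteq> {1..n}"
  shows "noise n r (chi U) x = r ^ card U * chi U x"
proof -
  have U: "{1..n} \<inter> U = U"
    using assms by auto
  have chi: "chi U y = (\<Prod>i\<in>{1..n}. if i \<in> U then of_int (y i) else 1)" for y
    by (simp add: chi_def U del: One_nat_def flip: prod.inter_restrict)
  have "noise n r (chi U) x
      = avg n (\<lambda>y. \<Prod>i\<in>{1..n}. (1 + r * (of_int (x i) * of_int (y i))) *
          (if i \<in> U then of_int (y i) else 1))"
    by (simp add: noise_def noise_kernel_def chi prod.distrib)
  also have "\<dots> = (\<Prod>i\<in>{1..n}. if i \<in> U then r * of_int (x i) else 1)"
    by (subst avg_prod[where q = "\<lambda>i b. (1 + r * (of_int (x i) * of_int b)) *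
          (if i \<in> U then of_int b else 1)"]) (intro prod.cong refl, simp)
  also have "\<dots> = (\<Prod>i\<in>U. r * of_int (x i))"
    by (simp add: U del: One_nat_def flip: prod.inter_restrict)
  also have "\<dots> = r ^ card U * chi U x"
    by (simp add: prod.distrib chi_def)
  finally show ?thesis .
qed

lemma fourier_noise: "U \<subseteq> {1..n} \<Longrightarrow> fourier n (noise n r f) U = r ^ card U * fourier n f U"
  unfolding fourier_def ip_noise_commute[symmetric]
  by (simp add: ip_def noise_chi mult_ac del: One_nat_def flip: avg_cmult)

text \<open>
  The semigroup law turns a stretch of the path that contains no player into a single step.
\<close>
lemma noise_noise: "noise n r (noise n s f) x = noise n (r * s) f x"
  by (simp add: noise_expansion[of n _ _ x] fourier_noise power_mult_distrib mult_ac
      cong: sum.cong_simp)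

lemma fourier_empty: "fourier n f {} = avg n f"
  by (simp add: fourier_def ip_def)

lemma noise_const: "noise n r (\<lambda>_. 1) x = 1"
  using noise_chi[of "{}" n r x] by (simp add: noise_def)

lemma avg_noise: "avg n (noise n r f) = avg n f"
  using fourier_noise[of "{}" n r f] by (simp add: fourier_empty)

section \<open>One noisy step restricted to half of the cube\<close>

lemma noise_cong: "(\<And>y. y \<in> cube n \<Longrightarrow> f y = g y) \<Longrightarrow> noise n r f x = noise n r g x"
  by (simp add: noise_def cong: avg_cong)

lemma noise_cmult: "noise n r (\<lambda>y. c * f y) x = c * noise n r f x"
  by (simp add: noise_def mult.left_commute avg_cmult)

lemma noise_add: "noise n r (\<lambda>y. f y + g y) x = noise n r f x + noise n r g x"
  by (simp add: noise_def avg_def ring_distribs sum.distrib add_divide_distrib)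

abbreviation nsq :: "nat \<Rightarrow> ((nat \<Rightarrow> int) \<Rightarrow> real) \<Rightarrow> real" where
  "nsq n f \<equiv> ip n f f"

lemma nsq_nonneg: "0 \<le> nsq n f"
  by (simp add: ip_def avg_def sum_nonneg)

lemma nsq_eq_0D: "nsq n f = 0 \<Longrightarrow> x \<in> cube n \<Longrightarrow> f x = 0"
  by (simp add: ip_def avg_def sum_nonneg_eq_0_iff)

lemma fourier_linear:
  "fourier n (\<lambda>x. a * f x + b * g x) U = a * fourier n f U + b * fourier n g U"
  by (simp add: fourier_def ip_def avg_def ring_distribs sum.distrib add_divide_distrib
      sum_distrib_left mult.assoc)

lemma nsq_diff:
  "nsq n (\<lambda>x. f x - c * g x) = nsq n f - 2 * c * ip n f g + c\<^sup>2 * nsq n g"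
  by (simp add: ip_def avg_def algebra_simps power2_eq_square sum.distrib sum_subtractf
      sum_distrib_left add_divide_distrib diff_divide_distrib)

lemma noise_form_nonneg: "0 \<le> r \<Longrightarrow> 0 \<le> ip n f (noise n r f)"
  unfolding ip_noise by (intro sum_nonneg) (simp add: mult.assoc)

text \<open>
  For \<open>r \<ge> 0\<close> the noise form is positive semidefinite, so bounds for its diagonal control the
  whole bilinear form.
\<close>
lemma noise_form_Cauchy_Schwarz:
  assumes "0 \<le> r"
  shows "(ip n f (noise n r g))\<^sup>2 \<le> ip n f (noise n r f) * ip n g (noise n r g)"
proof -
  define s where "s U = sqrt (r ^ card U)" for U :: "nat set"
  have s: "r ^ card U * a * b = (s U * a) * (s U * b)" for U and a b :: real
    using assms by (simp add: s_def)
  show ?thesis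
    unfolding ip_noise s using Cauchy_Schwarz_ineq_sum
    by (simp add: power2_eq_square)
qed

lemma noise_form_lower:
  assumes "0 \<le> r" "r \<le> 1"
  shows "r ^ n * nsq n f \<le> ip n f (noise n r f)"
  unfolding ip_noise unfolding parseval sum_distrib_left
proof (intro sum_mono)
  fix U assume "U \<in> Pow {1..n}"
  then have "card U \<le> n"
    using card_mono[of "{1..n}" U] by simp
  then have "r ^ n \<le> r ^ card U"
    using assms by (simp add: power_decreasing)
  then show "r ^ n * (fourier n f U * fourier n f U) \<le> r ^ card U * fourier n f U * fourier n f U"
    by (simp add: mult.assoc mult_right_mono)
qed

definition half_set :: "nat \<Rightarrow> (nat \<Rightarrow> int) set \<Rightarrow> bool" where
  "half_set n A \<longleftrightarrow> A \<subseteq> cube n \<and> avg n (indicator A) = 1/2"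

text \<open>
  The excess measures how far \<open>f\<close> is from being affine: a coefficient of degree \<open>d \<ge> 1\<close> is
  multiplied by \<open>r ^ d\<close> instead of \<open>r\<close>, and the excess collects these losses. Only the
  degrees \<open>d \<ge> 2\<close> contribute.
\<close>
definition excess :: "nat \<Rightarrow> real \<Rightarrow> ((nat \<Rightarrow> int) \<Rightarrow> real) \<Rightarrow> real" where
  "excess n r f = (\<Sum>U\<in>Pow {1..n} - {{}}. (r - r ^ card U) * (fourier n f U)\<^sup>2)"

abbreviation supported :: "nat \<Rightarrow> (nat \<Rightarrow> int) set \<Rightarrow> ((nat \<Rightarrow> int) \<Rightarrow> real) \<Rightarrow> bool" where
  "supported n A g \<equiv> \<forall>x\<in>cube n. x \<notin> A \<longrightarrow> g x = 0"

lemma excess_coeff_bounds: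
  fixes r :: real and n :: nat
  assumes "0 < r" "r < 1" "U \<in> Pow {1..n} - {{}}"
  shows "0 \<le> r - r ^ card U" "r - r ^ card U \<le> r"
proof -
  have "card U > 0"
    using assms by (auto simp: card_gt_0_iff dest: finite_subset[OF _ finite_atLeastAtMost])
  then have "r ^ card U \<le> r ^ 1"
    using assms by (intro power_decreasing) auto
  then show "0 \<le> r - r ^ card U" "r - r ^ card U \<le> r"
    using assms by auto
qed

lemma excess_nonneg: "0 < r \<Longrightarrow> r < 1 \<Longrightarrow> 0 \<le> excess n r f"
  unfolding excess_def by (intro sum_nonneg mult_nonneg_nonneg excess_coeff_bounds) auto

lemma nsq_split: "nsq n f = (avg n f)\<^sup>2 + (\<Sum>U\<in>Pow {1..n} - {{}}. (fourier n f U)\<^sup>2)"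
  unfolding parseval
  by (subst sum.remove[of _ "{}"]) (auto simp: fourier_empty power2_eq_square)

lemma noise_form_split:
  "ip n f (noise n r f) = (1 - r) * (avg n f)\<^sup>2 + r * nsq n f - excess n r f"
proof -
  have "ip n f (noise n r f)
      = (avg n f)\<^sup>2 + (\<Sum>U\<in>Pow {1..n} - {{}}. r ^ card U * (fourier n f U)\<^sup>2)"
    unfolding ip_noise
    by (subst sum.remove[of _ "{}"]) (auto simp: fourier_empty power2_eq_square mult.assoc)
  moreover have "excess n r f = r * (\<Sum>U\<in>Pow {1..n} - {{}}. (fourier n f U)\<^sup>2)
      - (\<Sum>U\<in>Pow {1..n} - {{}}. r ^ card U * (fourier n f U)\<^sup>2)"
    by (simp add: excess_def left_diff_distrib sum_subtractf sum_distrib_left)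
  ultimately show ?thesis
    by (simp add: nsq_split algebra_simps)
qed

lemma excess_le: 
  assumes "0 < r" "r < 1"
  shows "excess n r f \<le> nsq n f"
proof -
  have "excess n r f \<le> (\<Sum>U\<in>Pow {1..n} - {{}}. (fourier n f U)\<^sup>2)"
    unfolding excess_def
  proof (intro sum_mono)
    fix U assume U: "U \<in> Pow {1..n} - {{}}"
    show "(r - r ^ card U) * (fourier n f U)\<^sup>2 \<le> (fourier n f U)\<^sup>2"
      using excess_coeff_bounds[OF assms U] assms(2)
      by (intro mult_left_le_one_le zero_le_power2) linarith+
  qed
  then show ?thesis
    using zero_le_power2[of "avg n f"] unfolding nsq_split by linarith
qed

lemma nsq_indicator: "half_set n A \<Longrightarrow> nsq n (indicator A) = 1/2"
  by (simp add: half_set_def ip_def flip: indicator_inter_arith)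

text \<open>
  Dictator sets attain \<open>(1 + r) / 2\<close>; for every other half set the excess of the indicator lowers
  this value.
\<close>
definition step_bound :: "nat \<Rightarrow> real \<Rightarrow> (nat \<Rightarrow> int) set \<Rightarrow> real" where
  "step_bound n r A = (1 + r) / 2 - (1 - r) / 4 * excess n r (indicator A)"

text \<open>
  With \<open>g = c * indicator A + h\<close>, where \<open>h\<close> has mean zero, the deficit
  \<open>(1 + r) / 2 * nsq n g - ip n g (noise n r g)\<close> equals \<open>(1 - r) / 2 * nsq n h + excess n r g\<close>.
  The first term is the loss in the Cauchy-Schwarz bound for the mean of a function supported on half
  of the cube. The deficit can be small only if \<open>h\<close> is small, and then \<open>g\<close> is nearly a multiple of
  the indicator and inherits its excess. Since \<open>excess\<close> is the square of a seminorm bounded by the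
  norm, \<open>(a - b)\<^sup>2 \<le> 2 * a\<^sup>2 + 2 * b\<^sup>2\<close> makes this quantitative.
\<close>
lemma noise_form_gap:
  assumes r: "0 < r" "r < 1" and A: "half_set n A" and g: "supported n A g"
  shows "ip n g (noise n r g) \<le> step_bound n r A * nsq n g"
proof -
  define c where "c = 2 * avg n g"
  define h where "h x = g x - c * indicator A x" for x
  let ?\<tau> = "excess n r (indicator A)"
  have gA: "ip n g (indicator A) = c / 2"
    unfolding c_def ip_def using g by (auto intro!: avg_cong simp: indicator_def)
  have "nsq n h = nsq n g - 2 * c * ip n g (indicator A) + c\<^sup>2 * nsq n (indicator A)"
    unfolding h_def by (rule nsq_diff)
  then have h: "nsq n g = nsq n h + c\<^sup>2 / 2"
    using gA nsq_indicator[OF A] by (simp add: power2_eq_square)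
  have "excess n r (\<lambda>x. c * indicator A x) \<le> 2 * excess n r g + 2 * excess n r h"
    unfolding excess_def sum_distrib_left sum.distrib[symmetric]
  proof (intro sum_mono)
    fix U assume U: "U \<in> Pow {1..n} - {{}}"
    have *: "fourier n (\<lambda>x. c * indicator A x) U = fourier n g U - fourier n h U"
      using fourier_linear[of n 1 g "-1" h U] by (simp add: h_def)
    have "(a - b)\<^sup>2 \<le> 2 * a\<^sup>2 + 2 * b\<^sup>2" for a b :: real
      using zero_le_power2[of "a + b"] by (simp add: power2_sum power2_diff)
    then have "(r - r ^ card U) * (fourier n (\<lambda>x. c * indicator A x) U)\<^sup>2
        \<le> (r - r ^ card U) * (2 * (fourier n g U)\<^sup>2 + 2 * (fourier n h U)\<^sup>2)"
      unfolding * by (intro mult_left_mono excess_coeff_bounds(1)[OF r U]) auto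
    then show "(r - r ^ card U) * (fourier n (\<lambda>x. c * indicator A x) U)\<^sup>2
        \<le> 2 * ((r - r ^ card U) * (fourier n g U)\<^sup>2) + 2 * ((r - r ^ card U) * (fourier n h U)\<^sup>2)"
      by (simp add: algebra_simps)
  qed
  moreover have "excess n r (\<lambda>x. c * indicator A x) = c\<^sup>2 * ?\<tau>"
    using fourier_linear[of n c "indicator A" 0 "\<lambda>_. 0"]
    by (simp add: excess_def sum_distrib_left power_mult_distrib mult_ac)
  ultimately have "c\<^sup>2 * ?\<tau> \<le> 2 * excess n r g + 2 * nsq n h"
    using excess_le[OF r, of n h] by simp
  \<comment> \<open>Only a quarter of \<open>1 - r\<close> of the excess is used, so that the term \<open>- nsq n h\<close> consumes no
    more than half of the available \<open>(1 - r) / 2 * nsq n h\<close>.\<close>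
  then have "(1 - r) / 4 * (c\<^sup>2 * ?\<tau> / 2 - nsq n h) \<le> (1 - r) / 4 * excess n r g"
    using r by (intro mult_left_mono) auto
  also have "\<dots> \<le> excess n r g"
    using r excess_nonneg[OF r, of n g] by (intro mult_left_le_one_le) auto
  finally have N: "(1 - r) / 4 * (c\<^sup>2 * ?\<tau> / 2 - nsq n h) \<le> excess n r g" .
  have "?\<tau> * nsq n h \<le> 1 * nsq n h"
    using excess_le[OF r, of n "indicator A"] nsq_indicator[OF A] nsq_nonneg[of n h]
    by (intro mult_right_mono) auto
  then have "(1 - r) / 4 * (?\<tau> * nsq n h) \<le> (1 - r) / 4 * nsq n h"
    using r by (intro mult_left_mono) auto
  moreover have "ip n g (noise n r g)
      = (1 - r) * (c\<^sup>2 / 4) + r * (nsq n h + c\<^sup>2 / 2) - excess n r g"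
    unfolding noise_form_split h[symmetric] by (simp add: c_def power_mult_distrib)
  ultimately show ?thesis
    using N unfolding h step_bound_def by (simp add: field_simps)
qed

lemma step_bound_le: "0 < r \<Longrightarrow> r < 1 \<Longrightarrow> step_bound n r A \<le> (1 + r) / 2"
  unfolding step_bound_def by (simp only: diff_le_eq le_add_same_cancel1)
    (intro mult_nonneg_nonneg excess_nonneg, auto)

lemma step_bound_nonneg:
  assumes "0 < r" "r < 1" "half_set n A"
  shows "0 \<le> step_bound n r A"
proof -
  have "(1 - r) / 4 * excess n r (indicator A) \<le> (1 - r) / 4 * (1 / 2)"
    using assms excess_le[of r n "indicator A"] nsq_indicator[of n A]
    by (intro mult_left_mono) auto
  then show ?thesis
    using assms by (simp add: step_bound_def field_simps)
qed

definition restricted_step ::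
    "nat \<Rightarrow> real \<Rightarrow> (nat \<Rightarrow> int) set \<Rightarrow> ((nat \<Rightarrow> int) \<Rightarrow> real) \<Rightarrow> (nat \<Rightarrow> int) \<Rightarrow> real" where
  "restricted_step n r B g x = indicator B x * noise n r g x"

lemma ip_restricted_step: "ip n (restricted_step n r B g) (noise n r g) = nsq n (restricted_step n r B g)"
  by (auto simp: ip_def restricted_step_def indicator_def intro!: avg_cong)

text \<open>
  Since \<open>f = restricted_step n r B g\<close> agrees on \<open>B\<close> with \<open>noise n r g\<close> and vanishes
  elsewhere, its squared norm is the noise form at \<open>f\<close> and \<open>g\<close>, which Cauchy-Schwarz reduces
  to the two diagonal bounds.
\<close>
lemma nsq_restricted_step:
  assumes r: "0 < r" "r < 1" and A: "half_set n A" and B: "half_set n B" and g: "supported n A g"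
  shows "nsq n (restricted_step n r B g) \<le> step_bound n r B * step_bound n r A * nsq n g"
proof -
  let ?f = "restricted_step n r B g"
  have f: "supported n B ?f"
    by (simp add: restricted_step_def)
  have "nsq n ?f * nsq n ?f = (ip n ?f (noise n r g))\<^sup>2"
    by (simp add: ip_restricted_step power2_eq_square)
  also have "\<dots> \<le> ip n ?f (noise n r ?f) * ip n g (noise n r g)"
    using r by (intro noise_form_Cauchy_Schwarz) auto
  also have "\<dots> \<le> (step_bound n r B * nsq n ?f) * (step_bound n r A * nsq n g)"
    using r A B by (intro mult_mono noise_form_gap f g noise_form_nonneg mult_nonneg_nonneg
        step_bound_nonneg nsq_nonneg) auto
  finally have "nsq n ?f * nsq n ?f
      \<le> nsq n ?f * (step_bound n r B * step_bound n r A * nsq n g)"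
    by (simp add: mult_ac)
  moreover have "0 \<le> step_bound n r B * step_bound n r A * nsq n g"
    using r A B by (intro mult_nonneg_nonneg step_bound_nonneg nsq_nonneg) auto
  ultimately show ?thesis
    using nsq_nonneg[of n ?f] by (cases "nsq n ?f = 0") auto
qed

lemma half_set_subset_eq:
  assumes "half_set n A" "half_set n B" "A \<subseteq> B"
  shows "A = B"
proof -
  have "card A = card B"
    using assms by (simp add: half_set_def avg_def indicator_def sum.If_cases Int_absorb1)
  moreover have "finite B"
    using assms by (auto simp: half_set_def intro: finite_subset)
  ultimately show ?thesis
    using assms card_subset_eq by blast
qed

text \<open>
  In the extremal case let \<open>t = (1 + r) / 2\<close> and \<open>u = f - t * indicator A\<close>, where \<open>f\<close> is the
  restricted step. The diagonal bounds show that the noise form vanishes at \<open>u\<close>. For \<open>r > 0\<close> it is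
  positive definite, so \<open>f = t * indicator A\<close>; comparing supports gives \<open>A = B\<close>. The same
  computation leaves no room for a positive excess.
\<close>
lemma restricted_step_extremal:
  assumes r: "0 < r" "r < 1" and A: "half_set n A" and B: "half_set n B"
    and eq: "nsq n (restricted_step n r B (indicator A)) = ((1 + r) / 2)\<^sup>2 * (1/2)"
  shows "A = B" "excess n r (indicator A) = 0"
proof -
  let ?f = "restricted_step n r B (indicator A)"
  define t where "t = (1 + r) / 2"
  define u where "u x = ?f x - t * indicator A x" for x
  have t: "t > 0" "t \<le> 1"
    using r by (auto simp: t_def)
  have eq': "nsq n ?f = t\<^sup>2 / 2"
    using eq by (simp add: t_def)
  have f: "ip n ?f (noise n r ?f) \<le> t * (t\<^sup>2 / 2)"
  proof -
    have "ip n ?f (noise n r ?f) \<le> step_bound n r B * nsq n ?f"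
      by (intro noise_form_gap r B) (simp add: restricted_step_def)
    also have "\<dots> \<le> t * nsq n ?f"
      using step_bound_le[OF r] by (intro mult_right_mono nsq_nonneg) (simp add: t_def)
    finally show ?thesis
      unfolding eq' .
  qed
  have g: "ip n (indicator A) (noise n r (indicator A)) \<le> step_bound n r A / 2"
    using noise_form_gap[OF r A, of "indicator A"] nsq_indicator[OF A] by simp
  have fg: "ip n ?f (noise n r (indicator A)) = t\<^sup>2 / 2"
    using ip_restricted_step eq' by simp
  have "ip n u (noise n r u) = ip n ?f (noise n r ?f) - 2 * t * ip n ?f (noise n r (indicator A))
      + t\<^sup>2 * ip n (indicator A) (noise n r (indicator A))"
  proof -
    have u: "fourier n u U = fourier n ?f U - t * fourier n (indicator A) U" for U
      using fourier_linear[of n 1 ?f "-t" "indicator A" U] by (simp add: u_def[abs_def])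
    have "r ^ card U * fourier n u U * fourier n u U
       = r ^ card U * fourier n ?f U * fourier n ?f U
         - 2 * t * (r ^ card U * fourier n ?f U * fourier n (indicator A) U)
         + t\<^sup>2 * (r ^ card U * fourier n (indicator A) U * fourier n (indicator A) U)" for U
      unfolding u by (simp add: algebra_simps power2_eq_square)
    then show ?thesis
      by (simp add: ip_noise sum.distrib sum_subtractf sum_distrib_left)
  qed
  then have *: "ip n u (noise n r u) \<le> t\<^sup>2 * (step_bound n r A - t) / 2"
    using f fg mult_left_mono[OF g, of "t\<^sup>2"] by (simp add: power2_eq_square algebra_simps)
  have "0 \<le> t\<^sup>2 * (step_bound n r A - t)"
    using * noise_form_nonneg[of r n u] r by simp
  then have "t \<le> step_bound n r A"
    using t by (simp add: zero_le_mult_iff)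
  then have st: "step_bound n r A = t"
    using step_bound_le[OF r, of n A] by (simp add: t_def)
  then have "(1 - r) / 4 * excess n r (indicator A) = 0"
    unfolding step_bound_def t_def by linarith
  then show "excess n r (indicator A) = 0"
    using r by simp
  have "r ^ n * nsq n u \<le> 0"
    using noise_form_lower[of r n u] r * st by simp
  then have "nsq n u = 0"
    using nsq_nonneg[of n u] zero_less_power[OF r(1), of n] mult_pos_pos[of "r ^ n" "nsq n u"]
    by linarith
  then have u0: "?f x = t * indicator A x" if "x \<in> cube n" for x
    using nsq_eq_0D[of n u x] that by (simp add: u_def)
  have "A \<subseteq> B"
  proof
    fix x assume x: "x \<in> A"
    then have "x \<in> cube n"
      using A by (auto simp: half_set_def)
    from u0[OF this] x t show "x \<in> B"
      by (cases "x \<in> B") (auto simp: restricted_step_def)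
  qed
  then show "A = B"
    using half_set_subset_eq A B by blast
qed

section \<open>Half sets whose indicator has degree one\<close>

definition dictator_set :: "nat \<Rightarrow> (nat \<Rightarrow> int) set \<Rightarrow> bool" where
  "dictator_set n A \<longleftrightarrow> (\<exists>i\<in>{1..n}. \<exists>s\<in>{-1, 1}. A = {x \<in> cube n. x i = s})"

lemma sum_Pow_low_degree:
  fixes n :: nat
  assumes "\<And>U. U \<subseteq> {1..n} \<Longrightarrow> 2 \<le> card U \<Longrightarrow> F U = (0::real)"
  shows "(\<Sum>U\<in>Pow {1..n}. F U) = F {} + (\<Sum>i\<in>{1..n}. F {i})"
proof -
  have "(\<Sum>U\<in>Pow {1..n}. F U) = (\<Sum>U\<in>insert {} ((\<lambda>i. {i}) ` {1..n}). F U)"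
  proof (rule sum.mono_neutral_right)
    show "\<forall>U\<in>Pow {1..n} - insert {} ((\<lambda>i. {i}) ` {1..n}). F U = 0"
    proof
      fix U assume U: "U \<in> Pow {1..n} - insert {} ((\<lambda>i. {i}) ` {1..n})"
      then have "finite U"
        by (auto dest: finite_subset[OF _ finite_atLeastAtMost])
      with U have "card U \<noteq> 0" "card U \<noteq> 1"
        by (auto simp: card_1_singleton_iff)
      with U show "F U = 0"
        by (intro assms) auto
    qed
  qed auto
  also have "\<dots> = F {} + (\<Sum>U\<in>(\<lambda>i. {i}) ` {1..n}. F U)"
    by (subst sum.insert) auto
  also have "(\<Sum>U\<in>(\<lambda>i. {i}) ` {1..n}. F U) = (\<Sum>i\<in>{1..n}. F {i})"
    by (subst sum.reindex) (auto simp: inj_on_def)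
  finally show ?thesis .
qed

text \<open>
  The indicator is \<open>1/2 + (\<Sum>i. a i * x i)\<close>. Flipping the bit \<open>i\<close> changes it by \<open>2 * a i\<close>, which
  must be \<open>0\<close>, \<open>1\<close> or \<open>-1\<close>; so a nonzero \<open>a i\<close> is \<open>1/2\<close> or \<open>-1/2\<close> and exhausts
  the total weight \<open>1/4\<close> that Parseval leaves for degree one.
\<close>
lemma low_degree_imp_dictator_set:
  assumes A: "half_set n A"
    and low: "\<And>U. U \<subseteq> {1..n} \<Longrightarrow> 2 \<le> card U \<Longrightarrow> fourier n (indicator A) U = 0"
  shows "dictator_set n A"
proof -
  define a where "a i = fourier n (indicator A) {i}" for i
  have mean: "fourier n (indicator A) {} = 1/2"
    using A by (simp add: fourier_empty half_set_def)
  have sq: "(\<Sum>i\<in>{1..n}. (a i)\<^sup>2) = 1/4"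
    using nsq_indicator[OF A] unfolding parseval
    by (subst (asm) sum_Pow_low_degree) (auto simp: low mean a_def power2_eq_square)
  have aff: "indicator A x = 1/2 + (\<Sum>i\<in>{1..n}. a i * x i)" if "x \<in> cube n" for x
    using fourier_inversion[OF that, of "indicator A"]
    by (subst (asm) sum_Pow_low_degree) (auto simp: low mean a_def chi_def)
  obtain i where i: "i \<in> {1..n}" "a i \<noteq> 0"
  proof -
    have "\<exists>i\<in>{1..n}. a i \<noteq> 0"
      by (rule ccontr) (use sq in simp)
    then show ?thesis
      using that by blast
  qed
  define x :: "nat \<Rightarrow> int" where "x = (\<lambda>j\<in>{1..n}. 1)"
  define y where "y = x(i := -1)"
  have x: "x \<in> cube n" and y: "y \<in> cube n"
    using i by (auto simp: x_def y_def cube_def PiE_def extensional_def)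
  have "(\<Sum>j\<in>{1..n}. a j * x j) = a i + (\<Sum>j\<in>{1..n} - {i}. a j * x j)"
    using i by (subst sum.remove[of _ i]) (auto simp: x_def)
  moreover have "(\<Sum>j\<in>{1..n}. a j * y j) = - a i + (\<Sum>j\<in>{1..n} - {i}. a j * x j)"
    using i by (subst sum.remove[of _ i]) (auto simp: y_def)
  ultimately have "2 * a i = indicator A x - indicator A y"
    using aff[OF x] aff[OF y] by simp
  then have ai: "a i = 1/2 \<or> a i = -1/2"
    using i(2) by (cases "x \<in> A"; cases "y \<in> A") auto
  have "(\<Sum>j\<in>{1..n} - {i}. (a j)\<^sup>2) = 0"
  proof -
    have "2 * a i = 1 \<or> 2 * a i = -1"
      using ai by auto
    then have "(2 * a i)\<^sup>2 = 1"
      by (auto simp only: power_one power2_minus)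
    then have "(a i)\<^sup>2 = 1/4"
      by (simp add: power_mult_distrib)
    then show ?thesis
      using sq i by (subst (asm) sum.remove[of _ i]) auto
  qed
  then have aj: "a j = 0" if "j \<in> {1..n} - {i}" for j
    using that by (subst (asm) sum_nonneg_eq_0_iff) auto
  have ind: "indicator A z = 1/2 + a i * z i" if "z \<in> cube n" for z
    using aff[OF that] i aj by (subst (asm) sum.remove[of _ i]) auto
  define s :: int where "s = (if a i = 1/2 then 1 else -1)"
  have "z \<in> A \<longleftrightarrow> z i = s" if "z \<in> cube n" for z
    using ind[OF that] cube_bit[OF that i(1)] ai
    by (cases "z \<in> A") (auto simp: s_def split: if_splits)
  then have "A = {z \<in> cube n. z i = s}"
    using A by (auto simp: half_set_def)
  then show ?thesis
    using i by (auto simp: dictator_set_def s_def)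
qed

text \<open>
  Up to the factor \<open>2 ^ n\<close> the coefficients of an indicator are integers, so a nonzero one cannot be
  arbitrarily small.
\<close>
lemma fourier_indicator_bound:
  assumes "fourier n (indicator A) U \<noteq> 0"
  shows "1 / 4 ^ n \<le> (fourier n (indicator A) U)\<^sup>2"
proof -
  define m :: int where "m = (\<Sum>x\<in>cube n. indicator A x * (\<Prod>i\<in>U. x i))"
  have "real_of_int m = (\<Sum>x\<in>cube n. indicator A x * chi U x)"
    by (simp add: m_def chi_def indicator_def if_distrib)
  then have eq: "fourier n (indicator A) U = m / 2 ^ n"
    by (simp add: fourier_def ip_def avg_def)
  then have "m \<noteq> 0"
    using assms by auto
  then have "1 \<le> \<bar>real_of_int m\<bar>"
    by linarith
  then have "1 \<le> (real_of_int m)\<^sup>2"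
    using one_le_power[of "\<bar>real_of_int m\<bar>" 2] by simp
  moreover have "(2 ^ n)\<^sup>2 = (4::real) ^ n"
    by (simp add: power2_eq_square flip: power_mult_distrib)
  ultimately show ?thesis
    by (simp add: eq power_divide divide_right_mono)
qed

text \<open>
  The bound is uniform over all half sets other than dictators, which makes the constant in the
  exponential decay depend on \<open>r\<close> and \<open>n\<close> only.
\<close>
lemma excess_lower_bound:
  assumes r: "0 < r" "r < 1" and A: "half_set n A" "\<not> dictator_set n A"
  shows "(r - r\<^sup>2) / 4 ^ n \<le> excess n r (indicator A)"
proof -
  obtain U where U: "U \<subseteq> {1..n}" "2 \<le> card U" "fourier n (indicator A) U \<noteq> 0"
    using low_degree_imp_dictator_set A by blast
  have "r ^ card U \<le> r\<^sup>2"
    using r U by (intro power_decreasing) auto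
  moreover have "r\<^sup>2 \<le> r"
    using r by (simp add: power2_eq_square mult_left_le)
  ultimately have "(r - r\<^sup>2) * (1 / 4 ^ n) \<le> (r - r ^ card U) * (fourier n (indicator A) U)\<^sup>2"
    using fourier_indicator_bound[OF U(3)] by (intro mult_mono) auto
  also have "\<dots> \<le> excess n r (indicator A)"
    unfolding excess_def using U
    by (intro member_le_sum mult_nonneg_nonneg excess_coeff_bounds r) auto
  finally show ?thesis
    by simp
qed

lemma excess_0_imp_dictator_set:
  assumes "0 < r" "r < 1" "half_set n A" "excess n r (indicator A) = 0"
  shows "dictator_set n A"
proof (rule ccontr)
  assume "\<not> dictator_set n A"
  then have "(r - r\<^sup>2) / 4 ^ n \<le> 0"
    using excess_lower_bound[OF assms(1-3)] assms(4) by simp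
  moreover have "0 < (r - r\<^sup>2) / 4 ^ n"
    using assms(1,2) by (intro divide_pos_pos) (simp_all add: power2_eq_square)
  ultimately show False
    by linarith
qed

lemma indicator_bit_level:
  fixes s :: int
  assumes "i \<in> {1..n}" "s \<in> {-1, 1}" "y \<in> cube n"
  shows "indicator {x \<in> cube n. x i = s} y = 1/2 * 1 + s / 2 * chi {i} y"
  using cube_bit[OF assms(3,1)] assms(2,3) by (cases "y i = s") (auto simp: chi_def)

text \<open>
  The indicator of a dictator set is an eigenvector of the restricted step; hence the
  bound \<open>(1 + r) / 2\<close> is attained by dictators.
\<close>
lemma restricted_step_dictator:
  assumes "dictator_set n A"
  shows "restricted_step n r A (indicator A) x = (1 + r) / 2 * indicator A x"
proof -
  obtain i s where i: "i \<in> {1..n}" and s: "s \<in> {-1, 1}"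
    and A: "A = {x \<in> cube n. x i = s}"
    using assms unfolding dictator_set_def by (elim bexE) (rule that)
  have "noise n r (indicator A) x = noise n r (\<lambda>y. 1/2 * 1 + s / 2 * chi {i} y) x"
    unfolding A by (intro noise_cong indicator_bit_level i s)
  also have "\<dots> = 1 / 2 + r * (s * x i) / 2"
    using i unfolding noise_add noise_cmult noise_const by (subst noise_chi) (auto simp: chi_def)
  finally show ?thesis
    using s by (auto simp: restricted_step_def A indicator_def add_divide_distrib)
qed

section \<open>Iterating restricted steps along the path\<close>

text \<open>
  The value at \<open>x\<close> of the \<open>j\<close>-th function is the probability, conditional on player \<open>j\<close> holding the
  string \<open>x\<close>, that each of the players \<open>0, \<dots>, j\<close> holds a string of its set \<open>A\<close>;
  \<open>r j\<close> is the correlation between the players \<open>j\<close> and \<open>j + 1\<close>.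
\<close>
primrec restricted_walk ::
    "nat \<Rightarrow> (nat \<Rightarrow> real) \<Rightarrow> (nat \<Rightarrow> (nat \<Rightarrow> int) set) \<Rightarrow> nat \<Rightarrow> (nat \<Rightarrow> int) \<Rightarrow> real" where
  "restricted_walk n r A 0 = indicator (A 0)"
| "restricted_walk n r A (Suc j) = restricted_step n (r j) (A (Suc j)) (restricted_walk n r A j)"

lemma supported_restricted_walk: "supported n (A j) (restricted_walk n r A j)"
  by (cases j) (auto simp: restricted_step_def)

lemma nsq_restricted_walk_le:
  assumes "\<And>j. j < l \<Longrightarrow> 0 < r j \<and> r j < 1" and "\<And>j. j \<le> l \<Longrightarrow> half_set n (A j)"
    and "\<And>j. j < l \<Longrightarrow> step_bound n (r j) (A j) \<le> b j \<and> step_bound n (r j) (A (Suc j)) \<le> b j"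
  shows "nsq n (restricted_walk n r A l) \<le> (\<Prod>j<l. (b j)\<^sup>2) / 2"
  using assms
proof (induction l)
  case 0
  then show ?case
    using nsq_indicator[of n "A 0"] by simp
next
  case (Suc l)
  have "nsq n (restricted_walk n r A (Suc l))
      \<le> step_bound n (r l) (A (Suc l)) * step_bound n (r l) (A l) * nsq n (restricted_walk n r A l)"
    using Suc.prems by (auto intro!: nsq_restricted_step supported_restricted_walk)
  also have "\<dots> \<le> (b l)\<^sup>2 * nsq n (restricted_walk n r A l)"
    unfolding power2_eq_square using Suc.prems step_bound_nonneg[of "r l" n "A l"]
      step_bound_nonneg[of "r l" n "A (Suc l)"]
    by (intro mult_right_mono nsq_nonneg mult_mono) (auto intro: order_trans)
  also have "\<dots> \<le> (b l)\<^sup>2 * ((\<Prod>j<l. (b j)\<^sup>2) / 2)"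
    using Suc by (intro mult_left_mono) auto
  finally show ?case
    by (simp add: mult_ac)
qed

text \<open>
  Cauchy-Schwarz against the indicator of \<open>A\<close>, obtained from the noise form at \<open>r = 1\<close>.
\<close>
lemma avg_supported_le:
  assumes "half_set n A" "supported n A g"
  shows "(avg n g)\<^sup>2 \<le> nsq n g / 2"
proof -
  have "avg n g = ip n g (noise n 1 (indicator A))"
    unfolding ip_noise_1 unfolding ip_def
    using assms by (intro avg_cong) (auto simp: indicator_def)
  then have "(avg n g)\<^sup>2 \<le> ip n g (noise n 1 g) * ip n (indicator A) (noise n 1 (indicator A))"
    using noise_form_Cauchy_Schwarz[of 1 n g "indicator A"] by simp
  also have "\<dots> = nsq n g * nsq n (indicator A)"
    by (simp add: ip_noise_1)
  finally show ?thesis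
    using nsq_indicator[OF assms(1)] by simp
qed

text \<open>
  The parameter \<open>b\<close> serves two purposes: \<open>(1 + r j) / 2\<close> gives the bound valid for all half sets, and
  a smaller value gives the improvement for sets that are not dictators.
\<close>
lemma avg_restricted_walk_le:
  assumes "\<And>j. j < l \<Longrightarrow> 0 < r j \<and> r j < 1" and A: "\<And>j. j \<le> l \<Longrightarrow> half_set n (A j)"
    and "\<And>j. j < l \<Longrightarrow> step_bound n (r j) (A j) \<le> b j \<and> step_bound n (r j) (A (Suc j)) \<le> b j"
  shows "avg n (restricted_walk n r A l) \<le> (\<Prod>j<l. b j) / 2"
proof (rule power2_le_imp_le)
  show "(avg n (restricted_walk n r A l))\<^sup>2 \<le> ((\<Prod>j<l. b j) / 2)\<^sup>2"
    using avg_supported_le[OF A[OF le_refl] supported_restricted_walk[of n A l r]]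
      nsq_restricted_walk_le[of l r n A b] assms
    by (simp add: power_divide prod_power_distrib)
  have "0 \<le> b j" if "j < l" for j
    using assms that step_bound_nonneg[of "r j" n "A j"] by (force intro: order_trans)
  then show "0 \<le> (\<Prod>j<l. b j) / 2"
    by (auto intro: prod_nonneg)
qed

lemma restricted_step_cmult:
  "restricted_step n r B (\<lambda>x. c * g x) = (\<lambda>x. c * restricted_step n r B g x)"
  by (rule ext) (simp add: restricted_step_def noise_cmult)

lemma nsq_cmult: "nsq n (\<lambda>x. c * f x) = c\<^sup>2 * nsq n f"
  using avg_cmult[of n "c\<^sup>2" "\<lambda>x. f x * f x"] by (simp add: ip_def power2_eq_square mult_ac)

text \<open>
  Equality after \<open>l\<close> steps forces equality in every step. The equality case of a single step applies
  only to the indicator of a half set, which is why the shape of the walk is part of the induction: as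
  long as equality persists, the walk is a multiple of the indicator of one dictator set.
\<close>
lemma restricted_walk_extremal:
  assumes "\<And>j. j < l \<Longrightarrow> 0 < r j \<and> r j < 1" and "\<And>j. j \<le> l \<Longrightarrow> half_set n (A j)"
    and "nsq n (restricted_walk n r A l) = (\<Prod>j<l. ((1 + r j) / 2)\<^sup>2) / 2"
  shows "(\<forall>j\<le>l. A j = A 0) \<and> (0 < l \<longrightarrow> dictator_set n (A 0)) \<and>
    restricted_walk n r A l = (\<lambda>x. (\<Prod>j<l. (1 + r j) / 2) * indicator (A 0) x)"
  using assms
proof (induction l)
  case 0
  then show ?case
    by (auto simp: fun_eq_iff)
next
  case (Suc l)
  define t where "t j = (1 + r j) / 2" for j
  define P where "P = (\<Prod>j<l. t j)"
  have r: "0 < r l" "r l < 1"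
    using Suc.prems(1)[of l] by auto
  have t: "0 < t j" if "j \<le> l" for j
    using Suc.prems(1)[of j] that by (simp add: t_def)
  have P: "0 < P"
    unfolding P_def using t by (intro prod_pos) auto
  have eq: "nsq n (restricted_walk n r A (Suc l)) = (t l)\<^sup>2 * (P\<^sup>2 / 2)"
    using Suc.prems(3) by (simp add: P_def t_def prod_power_distrib mult_ac)
  have "nsq n (restricted_walk n r A (Suc l))
      \<le> step_bound n (r l) (A (Suc l)) * step_bound n (r l) (A l) * nsq n (restricted_walk n r A l)"
    using Suc.prems by (auto intro!: nsq_restricted_step supported_restricted_walk)
  also have "\<dots> \<le> (t l)\<^sup>2 * nsq n (restricted_walk n r A l)"
    unfolding power2_eq_square t_def
    using Suc.prems(2)[of l] Suc.prems(2)[of "Suc l"] r t[of l]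
    by (intro mult_right_mono nsq_nonneg mult_mono step_bound_le step_bound_nonneg) auto
  finally have "P\<^sup>2 / 2 \<le> nsq n (restricted_walk n r A l)"
    using t[of l] unfolding eq by (subst (asm) mult_le_cancel_left_pos) auto
  moreover have "nsq n (restricted_walk n r A l) \<le> (\<Prod>j<l. (t j)\<^sup>2) / 2"
    unfolding t_def using Suc.prems by (intro nsq_restricted_walk_le conjI step_bound_le) auto
  ultimately have "nsq n (restricted_walk n r A l) = (\<Prod>j<l. ((1 + r j) / 2)\<^sup>2) / 2"
    by (simp add: P_def prod_power_distrib t_def)
  note IH' = Suc.IH[OF Suc.prems(1)[OF less_SucI] Suc.prems(2)[OF le_SucI] this]
  have IH: "restricted_walk n r A l = (\<lambda>x. P * indicator (A 0) x)"
    unfolding P_def t_def by (rule IH'[THEN conjunct2, THEN conjunct2])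
  let ?f = "restricted_step n (r l) (A (Suc l)) (indicator (A 0))"
  have walk: "restricted_walk n r A (Suc l) = (\<lambda>x. P * ?f x)"
    unfolding restricted_walk.simps IH by (rule restricted_step_cmult)
  have "P\<^sup>2 * nsq n ?f = P\<^sup>2 * ((t l)\<^sup>2 * (1 / 2))"
    using eq unfolding walk nsq_cmult by simp
  then have "nsq n ?f = ((1 + r l) / 2)\<^sup>2 * (1/2)"
    using P by (simp add: t_def)
  note ex = restricted_step_extremal[OF r Suc.prems(2)[of 0] Suc.prems(2)[of "Suc l"] this]
  have A: "A (Suc l) = A 0" "dictator_set n (A 0)"
    using ex excess_0_imp_dictator_set[OF r Suc.prems(2)[of 0]] by auto
  have "restricted_walk n r A (Suc l) = (\<lambda>x. (\<Prod>j<Suc l. (1 + r j) / 2) * indicator (A 0) x)"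
    unfolding walk A(1) by (simp add: restricted_step_dictator[OF A(2)] P_def t_def mult_ac)
  moreover have "\<forall>j\<le>Suc l. A j = A 0"
  proof (intro allI impI)
    fix j assume "j \<le> Suc l"
    then show "A j = A 0"
      using A(1) IH'[THEN conjunct1, rule_format, of j] by (cases "j = Suc l") simp_all
  qed
  ultimately show ?case
    using A(2) by (intro conjI impI)
qed

lemma avg_restricted_walk_extremal:
  assumes "0 < l" and r: "\<And>j. j < l \<Longrightarrow> 0 < r j \<and> r j < 1" and A: "\<And>j. j \<le> l \<Longrightarrow> half_set n (A j)"
    and eq: "avg n (restricted_walk n r A l) = (\<Prod>j<l. (1 + r j) / 2) / 2"
  shows "(\<forall>j\<le>l. A j = A 0) \<and> dictator_set n (A 0)"
proof -
  have "(\<Prod>j<l. ((1 + r j) / 2)\<^sup>2) / 2 \<le> nsq n (restricted_walk n r A l)"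
    using avg_supported_le[OF A[OF le_refl] supported_restricted_walk[of n A l r]]
    unfolding eq by (simp add: power_divide prod_power_distrib)
  moreover have "nsq n (restricted_walk n r A l) \<le> (\<Prod>j<l. ((1 + r j) / 2)\<^sup>2) / 2"
    using r A by (intro nsq_restricted_walk_le conjI step_bound_le) auto
  ultimately have "nsq n (restricted_walk n r A l) = (\<Prod>j<l. ((1 + r j) / 2)\<^sup>2) / 2"
    by simp
  note extremal = restricted_walk_extremal[OF r A this]
  show ?thesis
  proof
    show "\<forall>j\<le>l. A j = A 0"
      by (rule extremal[THEN conjunct1])
    show "dictator_set n (A 0)"
      by (rule extremal[THEN conjunct2, THEN conjunct1, THEN mp]) (simp_all add: \<open>0 < l\<close>)
  qed
qed

lemma restricted_walk_dictator:
  assumes "\<And>j. j \<le> l \<Longrightarrow> A j = D" "dictator_set n D"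
  shows "restricted_walk n r A l x = (\<Prod>j<l. (1 + r j) / 2) * indicator D x"
  using assms
proof (induction l arbitrary: x)
  case (Suc l)
  then have IH: "restricted_walk n r A l = (\<lambda>x. (\<Prod>j<l. (1 + r j) / 2) * indicator D x)"
    by auto
  have D: "A (Suc l) = D"
    using Suc.prems by simp
  show ?case
    unfolding restricted_walk.simps IH D fun_cong[OF restricted_step_cmult]
    by (simp add: restricted_step_dictator[OF Suc.prems(2)])
qed simp

section \<open>Vertices without a player\<close>

text \<open>
  The same recursion over all vertices of the path, with an arbitrary weight at each vertex; a vertex
  without a player gets the weight \<open>1\<close>.
\<close>
primrec weighted_walk ::
    "nat \<Rightarrow> real \<Rightarrow> (nat \<Rightarrow> (nat \<Rightarrow> int) \<Rightarrow> real) \<Rightarrow> nat \<Rightarrow> (nat \<Rightarrow> int) \<Rightarrow> real" where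
  "weighted_walk n \<rho> W 0 = W 0"
| "weighted_walk n \<rho> W (Suc k) = (\<lambda>x. W (Suc k) x * noise n \<rho> (weighted_walk n \<rho> W k) x)"

definition player_weight ::
    "nat set \<Rightarrow> (nat \<Rightarrow> (nat \<Rightarrow> int) set) \<Rightarrow> nat \<Rightarrow> (nat \<Rightarrow> int) \<Rightarrow> real" where
  "player_weight S A v = (if v \<in> S then indicator (A v) else (\<lambda>_. 1))"

lemma player_weight_player: "v \<in> S \<Longrightarrow> player_weight S A v = indicator (A v)"
  by (simp add: player_weight_def)

lemma player_weight_free: "v \<notin> S \<Longrightarrow> player_weight S A v = (\<lambda>_. 1)"
  by (simp add: player_weight_def)

lemma weighted_walk_free_segment:
  assumes "a \<le> b" "\<And>v. a < v \<Longrightarrow> v \<le> b \<Longrightarrow> v \<notin> S" "x \<in> cube n"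
  shows "weighted_walk n \<rho> (player_weight S A) b x
    = noise n (\<rho> ^ (b - a)) (weighted_walk n \<rho> (player_weight S A) a) x"
  using assms
proof (induction b arbitrary: x rule: dec_induct)
  case base
  then show ?case
    by (simp add: noise_1)
next
  case (step b)
  let ?w = "weighted_walk n \<rho> (player_weight S A)"
  have "?w (Suc b) x = noise n \<rho> (?w b) x"
    using step by (simp add: player_weight_free)
  also have "\<dots> = noise n \<rho> (noise n (\<rho> ^ (b - a)) (?w a)) x"
    using step by (intro noise_cong) auto
  also have "\<dots> = noise n (\<rho> ^ (Suc b - a)) (?w a) x"
    using step by (simp add: noise_noise Suc_diff_le)
  finally show ?case .
qed

lemma weighted_walk_enumerated:
  assumes i: "strict_mono_on {0..l} i" and S: "S = i ` {0..l}" and "j \<le> l" "x \<in> cube n"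
  shows "weighted_walk n \<rho> (player_weight S A) (i j) x
    = restricted_walk n (\<lambda>j. \<rho> ^ (i (Suc j) - i j)) (A \<circ> i) j x"
  using assms(3,4)
proof (induction j arbitrary: x)
  case 0
  have S0: "i 0 \<in> S"
    using S by auto
  show ?case
  proof (cases "i 0")
    case 0
    then show ?thesis
      using S0 by (simp add: player_weight_player)
  next
    case (Suc b)
    have free: "v \<notin> S" if "v \<le> b" for v
    proof
      assume "v \<in> S"
      then obtain m where m: "m \<le> l" "v = i m"
        using S by auto
      then have "i 0 \<le> v"
        using mono_onD[OF strict_mono_on_imp_mono_on[OF i], of 0 m] by auto
      with that Suc show False
        by simp
    qed
    have 1: "weighted_walk n \<rho> (player_weight S A) b y = 1" if "y \<in> cube n" for y
    proof -
      have "weighted_walk n \<rho> (player_weight S A) b y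
          = noise n (\<rho> ^ (b - 0)) (weighted_walk n \<rho> (player_weight S A) 0) y"
        using that free by (intro weighted_walk_free_segment) auto
      also have "\<dots> = 1"
        using free by (simp add: player_weight_free noise_const)
      finally show ?thesis .
    qed
    have "noise n \<rho> (weighted_walk n \<rho> (player_weight S A) b) x = noise n \<rho> (\<lambda>_. 1) x"
      by (intro noise_cong 1)
    then show ?thesis
      using S0 Suc by (simp add: noise_const player_weight_player)
  qed
next
  case (Suc j)
  let ?w = "weighted_walk n \<rho> (player_weight S A)"
  have lt: "i j < i (Suc j)"
    using strict_mono_onD[OF i, of j "Suc j"] Suc.prems by simp
  then obtain b where b: "i (Suc j) = Suc b" "i j \<le> b"
    by (cases "i (Suc j)") auto
  have free: "v \<notin> S" if "i j < v" "v \<le> b" for v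
  proof
    assume "v \<in> S"
    then obtain m where m: "m \<le> l" "v = i m"
      using S by auto
    have "i m \<le> i j" if "m \<le> j"
      using mono_onD[OF strict_mono_on_imp_mono_on[OF i], of m j] that Suc.prems by auto
    moreover have "i (Suc j) \<le> i m" if "Suc j \<le> m"
      using mono_onD[OF strict_mono_on_imp_mono_on[OF i], of "Suc j" m] that m Suc.prems by auto
    ultimately show False
      using that m b by (cases "m \<le> j") auto
  qed
  have "noise n \<rho> (?w b) x = noise n \<rho> (noise n (\<rho> ^ (b - i j)) (?w (i j))) x"
    by (intro noise_cong weighted_walk_free_segment free b)
  also have "\<dots> = noise n (\<rho> ^ (i (Suc j) - i j)) (?w (i j)) x"
    using b by (simp add: noise_noise Suc_diff_le)
  also have "\<dots> = noise n (\<rho> ^ (i (Suc j) - i j))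
      (restricted_walk n (\<lambda>j. \<rho> ^ (i (Suc j) - i j)) (A \<circ> i) j) x"
    by (intro noise_cong Suc.IH) (use Suc.prems in auto)
  finally have "noise n \<rho> (?w b) x = noise n (\<rho> ^ (i (Suc j) - i j))
      (restricted_walk n (\<lambda>j. \<rho> ^ (i (Suc j) - i j)) (A \<circ> i) j) x" .
  moreover have "Suc b \<in> S"
    using S Suc.prems b(1) by (metis atLeastAtMost_iff imageI zero_le)
  ultimately show ?case
    unfolding restricted_walk.simps restricted_step_def b(1)
    by (simp add: b(1) player_weight_player)
qed

lemma avg_weighted_walk:
  assumes i: "strict_mono_on {0..l} i" and S: "S = i ` {0..l}" and k: "S \<subseteq> {0..k}"
  shows "avg n (weighted_walk n \<rho> (player_weight S A) k)
    = avg n (restricted_walk n (\<lambda>j. \<rho> ^ (i (Suc j) - i j)) (A \<circ> i) l)"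
proof -
  have free: "v \<notin> S" if "i l < v" for v
  proof
    assume "v \<in> S"
    then obtain m where "m \<le> l" "v = i m"
      using S by auto
    with that show False
      using mono_onD[OF strict_mono_on_imp_mono_on[OF i], of m l] by simp
  qed
  have "i l \<le> k"
    using k S by (metis atLeastAtMost_iff image_subset_iff order_refl zero_le)
  then have "avg n (weighted_walk n \<rho> (player_weight S A) k)
      = avg n (noise n (\<rho> ^ (k - i l)) (weighted_walk n \<rho> (player_weight S A) (i l)))"
    using free by (intro avg_cong weighted_walk_free_segment) auto
  also have "\<dots> = avg n (restricted_walk n (\<lambda>j. \<rho> ^ (i (Suc j) - i j)) (A \<circ> i) l)"
    unfolding avg_noise by (intro avg_cong weighted_walk_enumerated[OF i S]) auto
  finally show ?thesis .
qed

section \<open>The success probability as an average of a walk\<close>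

text \<open>
  All spaces are finite, so the measure of an event is the sum of the masses of its outcomes.
\<close>
lemma measure_nicd:
  assumes V: "finite V" and w: "\<And>\<alpha>. 0 \<le> spin_weight E \<rho> \<alpha>"
    and X: "X \<subseteq> {1..n} \<rightarrow>\<^sub>E (V \<rightarrow>\<^sub>E {-1, 1})"
  shows "measure (nicd_measure V E \<rho> n) X = (\<Sum>\<omega>\<in>X. \<Prod>i\<in>{1..n}. spin_weight E \<rho> (\<omega> i))"
proof -
  let ?\<Omega> = "V \<rightarrow>\<^sub>E {-1, 1::int}"
  have fin: "finite ?\<Omega>"
    using V by (intro finite_PiE) auto
  have em: "emeasure (spin_measure V E \<rho>) {\<alpha>} = ennreal (spin_weight E \<rho> \<alpha>)" if "\<alpha> \<in> ?\<Omega>" for \<alpha>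
    unfolding spin_measure_def using fin that by (subst emeasure_point_measure_finite) auto
  interpret M: finite_measure "spin_measure V E \<rho>"
    by (intro finite_measureI)
      (simp add: spin_measure_def space_point_measure emeasure_point_measure_finite[OF fin] fin
        ennreal_sum_less_top)
  interpret product_sigma_finite "\<lambda>_::nat. spin_measure V E \<rho>"
    by standard
  have sets: "{\<alpha>} \<in> sets (spin_measure V E \<rho>)" if "\<alpha> \<in> ?\<Omega>" for \<alpha>
    using that by (simp add: spin_measure_def sets_point_measure)
  have single: "{\<omega>} = (\<Pi>\<^sub>E i\<in>{1..n}. {\<omega> i})" if "\<omega> \<in> X" for \<omega>
    using that X by (subst PiE_singleton) (auto simp: PiE_def)
  have mem: "\<omega> i \<in> ?\<Omega>" if "\<omega> \<in> X" "i \<in> {1..n}" for \<omega> i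
    by (rule PiE_mem[OF subsetD[OF X that(1)] that(2)])
  have singleton_sets: "{\<omega>} \<in> sets (nicd_measure V E \<rho> n)" if "\<omega> \<in> X" for \<omega>
    unfolding nicd_measure_def
    by (subst single[OF that], intro sets_PiM_I_finite sets mem[OF that]) auto
  have singleton_em: "emeasure (nicd_measure V E \<rho> n) {\<omega>}
      = ennreal (\<Prod>i\<in>{1..n}. spin_weight E \<rho> (\<omega> i))" if "\<omega> \<in> X" for \<omega>
    unfolding nicd_measure_def
    by (subst single[OF that], subst emeasure_PiM)
      (use sets[OF mem[OF that]] in \<open>auto simp: em[OF mem[OF that]] prod_ennreal w\<close>)
  have "finite X"
    using finite_subset[OF X] fin by (simp add: finite_PiE)
  then have "measure (nicd_measure V E \<rho> n) X = (\<Sum>\<omega>\<in>X. measure (nicd_measure V E \<rho> n) {\<omega>})"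
    by (intro measure_eq_sum_singleton) (auto simp: singleton_sets singleton_em)
  also have "\<dots> = (\<Sum>\<omega>\<in>X. \<Prod>i\<in>{1..n}. spin_weight E \<rho> (\<omega> i))"
    by (intro sum.cong refl) (simp add: measure_def singleton_em prod_nonneg w)
  finally show ?thesis .
qed

lemma spin_weight_path:
  assumes "\<alpha> \<in> {0..k} \<rightarrow>\<^sub>E {-1, 1}"
  shows "spin_weight (path_edges k) \<rho> \<alpha>
    = 1/2 * (\<Prod>j<k. (1 + \<rho> * (of_int (\<alpha> j) * of_int (\<alpha> (Suc j)))) / 2)"
proof -
  have inj: "inj_on (\<lambda>j. {j, Suc j}) A" for A
    by (auto simp: inj_on_def doubleton_eq_iff)
  have agree: "agree_edges (path_edges k) \<alpha> = (\<lambda>j. {j, Suc j}) ` ({..<k} \<inter> {j. \<alpha> j = \<alpha> (Suc j)})"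
    by (auto simp: agree_edges_def path_edges_def)
  have disagree: "disagree_edges (path_edges k) \<alpha>
      = (\<lambda>j. {j, Suc j}) ` ({..<k} \<inter> - {j. \<alpha> j = \<alpha> (Suc j)})"
    by (auto simp: disagree_edges_def path_edges_def)
  have "(\<Prod>j<k. (1 + \<rho> * (of_int (\<alpha> j) * of_int (\<alpha> (Suc j)))) / 2)
      = (\<Prod>j<k. if \<alpha> j = \<alpha> (Suc j) then 1/2 + 1/2 * \<rho> else 1/2 - 1/2 * \<rho>)"
  proof (intro prod.cong refl)
    fix j assume "j \<in> {..<k}"
    then have "\<alpha> j \<in> {-1, 1}" "\<alpha> (Suc j) \<in> {-1, 1}"
      using PiE_mem[OF assms, of j] PiE_mem[OF assms, of "Suc j"] by auto
    then show "(1 + \<rho> * (of_int (\<alpha> j) * of_int (\<alpha> (Suc j)))) / 2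
        = (if \<alpha> j = \<alpha> (Suc j) then 1/2 + 1/2 * \<rho> else 1/2 - 1/2 * \<rho>)"
      by (auto simp: field_simps)
  qed
  then show ?thesis
    by (simp add: spin_weight_def agree disagree card_image[OF inj] prod.If_cases)
qed

lemma sum_PiE_insert:
  assumes "a \<notin> I"
  shows "(\<Sum>X\<in>insert a I \<rightarrow>\<^sub>E C. F X) = (\<Sum>X\<in>I \<rightarrow>\<^sub>E C. \<Sum>y\<in>C. F (X(a := y)))"
proof -
  have "(\<Sum>X\<in>insert a I \<rightarrow>\<^sub>E C. F X) = (\<Sum>(y, X)\<in>C \<times> (I \<rightarrow>\<^sub>E C). F (X(a := y)))"
    unfolding PiE_insert_eq
    by (subst sum.reindex[OF inj_combinator[OF assms]]) (auto intro!: sum.cong)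
  also have "\<dots> = (\<Sum>X\<in>I \<rightarrow>\<^sub>E C. \<Sum>y\<in>C. F (X(a := y)))"
    by (subst sum.cartesian_product[symmetric], subst sum.swap) simp
  finally show ?thesis .
qed

text \<open>
  Summing out the strings at the vertices \<open>0, 1, \<dots>\<close> one after the other produces the walk. The test
  function \<open>u\<close> at the last vertex is what the induction needs: it absorbs the next step.
\<close>
lemma sum_paths:
  "(\<Sum>X\<in>{0..k} \<rightarrow>\<^sub>E cube n. (\<Prod>v\<in>{0..k}. W v (X v))
      * (\<Prod>v<k. noise_kernel n \<rho> (X v) (X (Suc v)) / 2 ^ n) * u (X k))
    = (\<Sum>y\<in>cube n. weighted_walk n \<rho> W k y * u y)"
proof (induction k arbitrary: u)
  case 0
  show ?case
    using sum_PiE_insert[of 0 "{}" "\<lambda>X. W 0 (X 0) * u (X 0)" "cube n"] by simp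
next
  case (Suc k)
  let ?K = "\<lambda>x y. noise_kernel n \<rho> x y / 2 ^ n"
  let ?P = "\<lambda>X. (\<Prod>v\<in>{0..k}. W v (X v)) * (\<Prod>v<k. ?K (X v) (X (Suc v)))"
  let ?u = "\<lambda>x. \<Sum>y\<in>cube n. W (Suc k) y * ?K x y * u y"
  have "(\<Sum>X\<in>{0..Suc k} \<rightarrow>\<^sub>E cube n. (\<Prod>v\<in>{0..Suc k}. W v (X v))
      * (\<Prod>v<Suc k. ?K (X v) (X (Suc v))) * u (X (Suc k)))
    = (\<Sum>X\<in>{0..k} \<rightarrow>\<^sub>E cube n. \<Sum>y\<in>cube n. ?P X * (W (Suc k) y * ?K (X k) y * u y))"
    unfolding atLeast0_atMost_Suc
    by (subst sum_PiE_insert) (auto simp: mult_ac intro!: sum.cong)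
  also have "\<dots> = (\<Sum>X\<in>{0..k} \<rightarrow>\<^sub>E cube n. ?P X * ?u (X k))"
    by (simp add: sum_distrib_left)
  also have "\<dots> = (\<Sum>x\<in>cube n. weighted_walk n \<rho> W k x * ?u x)"
    by (rule Suc.IH)
  also have "\<dots> = (\<Sum>y\<in>cube n. \<Sum>x\<in>cube n. weighted_walk n \<rho> W k x * (W (Suc k) y * ?K x y * u y))"
    unfolding sum_distrib_left by (rule sum.swap)
  also have "\<dots> = (\<Sum>y\<in>cube n. weighted_walk n \<rho> W (Suc k) y * u y)"
    by (intro sum.cong refl)
      (simp add: noise_def avg_def noise_kernel_commute[of n \<rho> _ "_"] sum_distrib_left
        sum_distrib_right sum_divide_distrib mult_ac)
  finally show ?case .
qed

text \<open>
  An outcome lists the bits coordinate by coordinate; reading it vertex by vertex identifies outcomes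
  with assignments of a string to each vertex.
\<close>
lemma sum_transpose:
  "(\<Sum>\<omega>\<in>{1..n} \<rightarrow>\<^sub>E (V \<rightarrow>\<^sub>E {-1, 1}). F (\<lambda>v\<in>V. player_string n \<omega> v)) = (\<Sum>X\<in>V \<rightarrow>\<^sub>E cube n. F X)"
  by (rule sum.reindex_bij_witness[where i = "\<lambda>X. \<lambda>i\<in>{1..n}. \<lambda>v\<in>V. X v i"
        and j = "\<lambda>\<omega>. \<lambda>v\<in>V. player_string n \<omega> v"])
    (auto simp: player_string_def cube_def fun_eq_iff PiE_iff extensional_def restrict_def)

lemma sum_subset_indicator:
  "finite B \<Longrightarrow> A \<subseteq> B \<Longrightarrow> (\<Sum>x\<in>A. p x) = (\<Sum>x\<in>B. indicator A x * p x)"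
  for p :: "'a \<Rightarrow> real"
  by (intro sum.mono_neutral_cong_left) auto

lemma sum_signs_if:
  "c \<in> {-1, 1} \<Longrightarrow> (\<Sum>b\<in>{-1, 1}. if P \<and> c = b then 1 else 0) = (of_bool P :: real)"
  for c :: int
  by auto

text \<open>
  Players who agree do so on exactly one of the two values \<open>b\<close>. For fixed \<open>b\<close> the event is a product of
  conditions on the single strings, and the mass of an outcome is a product of noise kernels along the
  path, so that the sum over outcomes is a weighted walk.
\<close>
lemma success_prob_path:
  assumes \<rho>: "0 < \<rho>" "\<rho> < 1" and S: "S \<subseteq> path_verts k" "S \<noteq> {}" and f: "protocol n S f"
  shows "success_prob (path_verts k) (path_edges k) \<rho> n S f
    = (\<Sum>b\<in>{-1, 1}. avg n (weighted_walk n \<rho> (player_weight S (\<lambda>v. {x \<in> cube n. f v x = b})) k))"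
proof -
  let ?V = "{0..k}"
  let ?\<Omega> = "{1..n} \<rightarrow>\<^sub>E (?V \<rightarrow>\<^sub>E {-1, 1::int})"
  let ?W = "\<lambda>b. player_weight S (\<lambda>v. {x \<in> cube n. f v x = b})"
  let ?s = "player_string n"
  let ?p = "\<lambda>\<omega>. \<Prod>i\<in>{1..n}. spin_weight (path_edges k) \<rho> (\<omega> i)"
  let ?E = "{\<omega> \<in> ?\<Omega>. \<forall>u\<in>S. \<forall>v\<in>S. f u (?s \<omega> u) = f v (?s \<omega> v)}"
  have fin: "finite ?\<Omega>"
    by (intro finite_PiE) auto
  have SV: "S \<subseteq> ?V"
    using S by (simp add: path_verts_def)
  have s: "?s \<omega> v \<in> cube n" if "\<omega> \<in> ?\<Omega>" "v \<in> ?V" for \<omega> v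
    using that by (auto simp: player_string_def cube_def PiE_iff)
  have W: "(\<Prod>v\<in>?V. ?W b v (?s \<omega> v)) = (if \<forall>v\<in>S. f v (?s \<omega> v) = b then 1 else 0)"
    if "\<omega> \<in> ?\<Omega>" for \<omega> b
  proof -
    have "(\<Prod>v\<in>?V. ?W b v (?s \<omega> v)) = (\<Prod>v\<in>?V. if v \<in> S \<and> f v (?s \<omega> v) \<noteq> b then 0 else 1)"
      using s[OF that] by (intro prod.cong refl) (auto simp: player_weight_def)
    also have "\<dots> = (if \<forall>v\<in>S. f v (?s \<omega> v) = b then 1 else 0)"
      using SV by (auto intro!: prod.neutral prod_zero)
    finally show ?thesis .
  qed
  have sum_W: "(\<Sum>b\<in>{-1, 1}. \<Prod>v\<in>?V. ?W b v (?s \<omega> v)) = indicator ?E \<omega>" if "\<omega> \<in> ?\<Omega>" for \<omega>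
  proof -
    obtain v0 where v0: "v0 \<in> S"
      using S by auto
    have "?s \<omega> v0 \<in> cube n"
      using s[OF that] v0 SV by auto
    then have sign: "f v0 (?s \<omega> v0) \<in> {-1, 1}"
      using f v0 by (auto simp: protocol_def balanced_def)
    have level: "(\<forall>v\<in>S. f v (?s \<omega> v) = b) \<longleftrightarrow> \<omega> \<in> ?E \<and> f v0 (?s \<omega> v0) = b" for b
    proof
      assume "\<forall>v\<in>S. f v (?s \<omega> v) = b"
      then show "\<omega> \<in> ?E \<and> f v0 (?s \<omega> v0) = b"
        using that v0 by simp
    next
      assume *: "\<omega> \<in> ?E \<and> f v0 (?s \<omega> v0) = b"
      show "\<forall>v\<in>S. f v (?s \<omega> v) = b"
      proof
        fix v assume "v \<in> S"
        then have "f v (?s \<omega> v) = f v0 (?s \<omega> v0)"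
          using * v0 by blast
        with * show "f v (?s \<omega> v) = b"
          by simp
      qed
    qed
    show ?thesis
      unfolding W[OF that] level indicator_def by (rule sum_signs_if[OF sign])
  qed
  have weight: "?p \<omega> = (\<Prod>v<k. noise_kernel n \<rho> (?s \<omega> v) (?s \<omega> (Suc v)) / 2 ^ n) * (1 / 2 ^ n)"
    if "\<omega> \<in> ?\<Omega>" for \<omega>
  proof -
    have kernel: "(\<Prod>i\<in>{1..n}. (1 + \<rho> * (of_int (\<omega> i v) * of_int (\<omega> i (Suc v)))) / 2)
        = noise_kernel n \<rho> (?s \<omega> v) (?s \<omega> (Suc v)) / 2 ^ n" for v
      by (simp add: noise_kernel_def player_string_def prod_dividef)
    have "?p \<omega> = (\<Prod>i\<in>{1..n}. 1/2 * (\<Prod>v<k. (1 + \<rho> * (of_int (\<omega> i v) * of_int (\<omega> i (Suc v)))) / 2))"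
      using that by (intro prod.cong refl spin_weight_path) auto
    also have "\<dots> = (\<Prod>v<k. \<Prod>i\<in>{1..n}. (1 + \<rho> * (of_int (\<omega> i v) * of_int (\<omega> i (Suc v)))) / 2)
        * (1 / 2 ^ n)"
      by (subst prod.swap) (simp add: prod_dividef)
    finally show ?thesis
      unfolding kernel .
  qed
  have "success_prob (path_verts k) (path_edges k) \<rho> n S f
      = measure (nicd_measure ?V (path_edges k) \<rho> n) ?E"
    by (simp add: success_prob_def path_verts_def nicd_measure_def space_PiM spin_measure_def
        space_point_measure)
  also have "\<dots> = (\<Sum>\<omega>\<in>?E. ?p \<omega>)"
    by (intro measure_nicd Collect_subset) (use \<rho> in \<open>simp_all add: spin_weight_def\<close>)
  also have "\<dots> = (\<Sum>\<omega>\<in>?\<Omega>. indicator ?E \<omega> * ?p \<omega>)"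
    by (rule sum_subset_indicator[OF fin Collect_subset])
  also have "\<dots> = (\<Sum>\<omega>\<in>?\<Omega>. \<Sum>b\<in>{-1, 1}. (\<Prod>v\<in>?V. ?W b v (?s \<omega> v)) * ?p \<omega>)"
    by (intro sum.cong refl) (subst sum_W[symmetric], assumption, rule sum_distrib_right)
  also have "\<dots> = (\<Sum>b\<in>{-1, 1}. \<Sum>\<omega>\<in>?\<Omega>. (\<Prod>v\<in>?V. ?W b v (?s \<omega> v)) * ?p \<omega>)"
    by (rule sum.swap)
  also have "\<dots> = (\<Sum>b\<in>{-1, 1}. avg n (weighted_walk n \<rho> (?W b) k))"
  proof (intro sum.cong refl)
    fix b :: int
    have "(\<Sum>\<omega>\<in>?\<Omega>. (\<Prod>v\<in>?V. ?W b v (?s \<omega> v)) * ?p \<omega>)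
        = (\<Sum>X\<in>?V \<rightarrow>\<^sub>E cube n. (\<Prod>v\<in>?V. ?W b v (X v))
            * (\<Prod>v<k. noise_kernel n \<rho> (X v) (X (Suc v)) / 2 ^ n) * (1 / 2 ^ n))"
      unfolding sum_transpose[symmetric]
      by (intro sum.cong refl) (simp add: weight del: One_nat_def)
    also have "\<dots> = avg n (weighted_walk n \<rho> (?W b) k)"
      using sum_paths[of "?W b" k n \<rho> "\<lambda>_. 1 / 2 ^ n"] by (simp add: avg_def sum_divide_distrib)
    finally show "(\<Sum>\<omega>\<in>?\<Omega>. (\<Prod>v\<in>?V. ?W b v (?s \<omega> v)) * ?p \<omega>)
        = avg n (weighted_walk n \<rho> (?W b) k)" .
  qed
  finally show ?thesis .
qed

section \<open>Optimal protocols on the path\<close>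

lemma avg_indicator: "A \<subseteq> cube n \<Longrightarrow> avg n (indicator A) = card A / 2 ^ n"
  by (simp add: avg_def indicator_def sum.If_cases Int_absorb1)

lemma half_set_iff_card:
  assumes "1 \<le> n" "A \<subseteq> cube n"
  shows "half_set n A \<longleftrightarrow> card A = 2 ^ (n - 1)"
proof -
  have "(2::real) ^ n = 2 * 2 ^ (n - 1)"
    using assms by (simp add: power_eq_if)
  then have "half_set n A \<longleftrightarrow> real (card A) = real (2 ^ (n - 1))"
    using assms by (auto simp: half_set_def avg_indicator field_simps)
  then show ?thesis
    unfolding of_nat_eq_iff .
qed

lemma half_set_dictator:
  assumes "dictator_set n D"
  shows "half_set n D"
proof -
  obtain i s where i: "i \<in> {1..n}" and s: "s \<in> {-1, 1}" and D: "D = {x \<in> cube n. x i = s}"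
    using assms unfolding dictator_set_def by (elim bexE) (rule that)
  have "avg n (indicator D) = avg n (\<lambda>x. 1/2 * 1 + s / 2 * chi {i} x)"
    unfolding D by (intro avg_cong indicator_bit_level i s)
  also have "\<dots> = 1/2 * avg n (\<lambda>_. 1) + s / 2 * avg n (chi {i})"
    by (simp add: avg_def sum.distrib sum_distrib_left add_divide_distrib)
  also have "avg n (chi {i}) = 0"
    using fourier_noise[of "{}" n 0 "chi {i}"] i avg_noise[of n 0 "chi {i}"]
      noise_chi[of "{i}" n 0] by (simp add: avg_def)
  finally show ?thesis
    by (auto simp: half_set_def D avg_def card_cube)
qed

lemma half_set_level:
  assumes "1 \<le> n" "balanced n f" "b \<in> {-1, 1}"
  shows "half_set n {x \<in> cube n. f x = b}"
  using assms by (subst half_set_iff_card) (auto simp: balanced_def)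

text \<open>
  Being a dictator can be read off either level set, so it suffices to treat one of the two values.
\<close>
lemma dictator_set_level_iff:
  assumes f: "f \<in> cube n \<rightarrow> {-1, 1}" and b: "b \<in> {-1, 1}"
  shows "dictator_set n {x \<in> cube n. f x = b} \<longleftrightarrow> dictator n f"
proof
  assume "dictator_set n {x \<in> cube n. f x = b}"
  then obtain i s where i: "i \<in> {1..n}" and s: "s \<in> {-1, 1}"
    and eq: "{x \<in> cube n. f x = b} = {x \<in> cube n. x i = s}"
    unfolding dictator_set_def by (elim bexE) (rule that)
  have "f x = b * s * x i" if "x \<in> cube n" for x
  proof -
    have "f x = b \<longleftrightarrow> x i = s"
      using eq that by blast
    then show ?thesis
      using funcset_mem[OF f that] cube_bit[OF that i] b s by auto
  qed
  then have "(\<forall>x\<in>cube n. f x = x i) \<or> (\<forall>x\<in>cube n. f x = - x i)"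
    using b s by auto
  then show "dictator n f"
    using i unfolding dictator_def by (intro bexI[of _ i])
next
  assume "dictator n f"
  then obtain i where i: "i \<in> {1..n}"
    and f: "(\<forall>x\<in>cube n. f x = x i) \<or> (\<forall>x\<in>cube n. f x = - x i)"
    unfolding dictator_def by (elim bexE) (rule that)
  from f show "dictator_set n {x \<in> cube n. f x = b}"
  proof
    assume "\<forall>x\<in>cube n. f x = x i"
    then have "{x \<in> cube n. f x = b} = {x \<in> cube n. x i = b}"
      by auto
    then show ?thesis
      using i b unfolding dictator_set_def by (intro bexI[of _ i] bexI[of _ b])
  next
    assume "\<forall>x\<in>cube n. f x = - x i"
    then have "{x \<in> cube n. f x = b} = {x \<in> cube n. x i = - b}"
      by auto
    then show ?thesis
      using i b unfolding dictator_set_def by (intro bexI[of _ i] bexI[of _ "- b"]) auto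
  qed
qed

lemma dictator_imp_balanced:
  assumes "1 \<le> n" "dictator n f"
  shows "balanced n f"
proof -
  have f: "f \<in> cube n \<rightarrow> {-1, 1}"
    using assms(2) cube_bit[of _ n] unfolding dictator_def by fastforce
  have "card {x \<in> cube n. f x = b} = 2 ^ (n - 1)" if "b \<in> {-1, 1}" for b
  proof -
    have "half_set n {x \<in> cube n. f x = b}"
      using dictator_set_level_iff[OF f that] assms(2) by (intro half_set_dictator) simp
    then show ?thesis
      using half_set_iff_card[OF assms(1)] by simp
  qed
  with f show ?thesis
    by (simp add: balanced_def)
qed

lemma dictator_first: "1 \<le> n \<Longrightarrow> dictator n (\<lambda>x. x 1)"
  unfolding dictator_def by (intro bexI[of _ 1]) auto

text \<open>
  The players sit at the vertices \<open>i 0 < \<dots> < i l\<close> of the path.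
\<close>
locale path_players =
  fixes \<rho> :: real and k l :: nat and S :: "nat set" and i :: "nat \<Rightarrow> nat"
  assumes \<rho>: "0 < \<rho>" "\<rho> < 1"
    and S_path: "S \<subseteq> path_verts k"
    and i: "strict_mono_on {0..l} i"
    and S: "S = i ` {0..l}"
begin

definition r :: "nat \<Rightarrow> real" where
  "r j = \<rho> ^ (i (Suc j) - i j)"

definition optimum :: real where
  "optimum = (\<Prod>j<l. (1 + r j) / 2)"

definition player_level :: "(nat \<Rightarrow> (nat \<Rightarrow> int) \<Rightarrow> int) \<Rightarrow> nat \<Rightarrow> int \<Rightarrow> nat \<Rightarrow> (nat \<Rightarrow> int) set" where
  "player_level f n b j = {x \<in> cube n. f (i j) x = b}"

lemma r_bounds: "j < l \<Longrightarrow> 0 < r j \<and> r j < 1"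
  using strict_mono_onD[OF i, of j "Suc j"] \<rho> by (auto simp: r_def power_Suc_less_one power_less_one_iff)

lemma success_prob_eq:
  assumes "protocol n S f"
  shows "success_prob (path_verts k) (path_edges k) \<rho> n S f
    = avg n (restricted_walk n r (player_level f n (-1)) l)
      + avg n (restricted_walk n r (player_level f n 1) l)"
proof -
  have "avg n (weighted_walk n \<rho> (player_weight S (\<lambda>v. {x \<in> cube n. f v x = b})) k)
      = avg n (restricted_walk n r (player_level f n b) l)" for b
  proof -
    have "(\<lambda>v. {x \<in> cube n. f v x = b}) \<circ> i = player_level f n b"
      by (simp add: fun_eq_iff player_level_def)
    moreover have "(\<lambda>j. \<rho> ^ (i (Suc j) - i j)) = r"
      by (simp add: fun_eq_iff r_def)
    moreover have "S \<subseteq> {0..k}"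
      using S_path by (simp add: path_verts_def)
    ultimately show ?thesis
      using avg_weighted_walk[OF i S] by simp
  qed
  moreover have "S \<noteq> {}"
    using S by simp
  ultimately show ?thesis
    using success_prob_path[OF \<rho> S_path _ assms] by simp
qed

lemma half_set_player_level:
  assumes "1 \<le> n" "protocol n S f" "b \<in> {-1, 1}" "j \<le> l"
  shows "half_set n (player_level f n b j)"
  unfolding player_level_def
  using assms S by (intro half_set_level) (auto simp: protocol_def)

lemma level_prob_le:
  assumes "1 \<le> n" "protocol n S f" "b \<in> {-1, 1}"
  shows "avg n (restricted_walk n r (player_level f n b) l) \<le> optimum / 2"
  unfolding optimum_def using assms r_bounds half_set_player_level
  by (intro avg_restricted_walk_le conjI step_bound_le) auto

lemma success_prob_le_optimum:
  assumes "1 \<le> n" "protocol n S f"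
  shows "success_prob (path_verts k) (path_edges k) \<rho> n S f \<le> optimum"
  using level_prob_le[OF assms, of 1] level_prob_le[OF assms, of "-1"] success_prob_eq[OF assms(2)]
  by simp

lemma success_prob_dictator:
  assumes "1 \<le> n" "protocol n S f" "simple_dictator_protocol n S f"
  shows "success_prob (path_verts k) (path_edges k) \<rho> n S f = optimum"
proof -
  from assms(3) obtain d where "dictator n d \<and> (\<forall>v\<in>S. \<forall>x\<in>cube n. f v x = d x)"
    unfolding simple_dictator_protocol_def ..
  note d = this[THEN conjunct1] and f = this[THEN conjunct2]
  have level: "avg n (restricted_walk n r (player_level f n b) l) = optimum / 2" if b: "b \<in> {-1, 1}" for b
  proof -
    let ?D = "{x \<in> cube n. d x = b}"
    have D: "dictator_set n ?D"
      using dictator_set_level_iff[OF _ b, of d n] dictator_imp_balanced[OF assms(1) d] d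
      by (simp add: balanced_def)
    have "restricted_walk n r (player_level f n b) l
        = (\<lambda>x. (\<Prod>j<l. (1 + r j) / 2) * indicator ?D x)"
      by (rule ext, rule restricted_walk_dictator[OF _ D]) (use f S in \<open>auto simp: player_level_def\<close>)
    then show ?thesis
      using half_set_dictator[OF D] by (simp add: avg_cmult half_set_def optimum_def)
  qed
  show ?thesis
    using success_prob_eq[OF assms(2)] level[of 1] level[of "-1"] by simp
qed

text \<open>
  Each of the two values contributes at most half of the optimum, so in the extremal case both bounds
  are attained. The walk for the value \<open>1\<close> then shows that all players have the same level set, a
  dictator set.
\<close>
lemma success_prob_eq_optimum_imp_dictator:
  assumes "0 < l" "1 \<le> n" "protocol n S f"
    and eq: "success_prob (path_verts k) (path_edges k) \<rho> n S f = optimum"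
  shows "simple_dictator_protocol n S f"
proof -
  have avg: "avg n (restricted_walk n r (player_level f n 1) l) = (\<Prod>j<l. (1 + r j) / 2) / 2"
    using level_prob_le[OF assms(2,3), of 1] level_prob_le[OF assms(2,3), of "-1"]
      success_prob_eq[OF assms(3)] eq by (simp add: optimum_def)
  have extremal: "(\<forall>j\<le>l. player_level f n 1 j = player_level f n 1 0)
      \<and> dictator_set n (player_level f n 1 0)"
    by (rule avg_restricted_walk_extremal[OF assms(1) r_bounds half_set_player_level avg])
      (use assms in simp_all)
  have same: "player_level f n 1 j = player_level f n 1 0" if "j \<le> l" for j
    by (rule extremal[THEN conjunct1, rule_format, OF that])
  have "dictator_set n (player_level f n 1 0)"
    by (rule extremal[THEN conjunct2])
  moreover have fS: "f v \<in> cube n \<rightarrow> {-1, 1}" if "v \<in> S" for v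
    using assms(3) that by (simp add: protocol_def balanced_def)
  moreover have "i 0 \<in> S"
    using S by simp
  ultimately have "dictator n (f (i 0))"
    using dictator_set_level_iff[of "f (i 0)" n 1] by (simp add: player_level_def)
  moreover have "\<forall>v\<in>S. \<forall>x\<in>cube n. f v x = f (i 0) x"
  proof (intro ballI)
    fix v x assume v: "v \<in> S" and x: "x \<in> cube n"
    obtain j where j: "j \<le> l" "v = i j"
      using S v by auto
    have "x \<in> player_level f n 1 j \<longleftrightarrow> x \<in> player_level f n 1 0"
      by (simp only: same[OF j(1)])
    then have "f v x = 1 \<longleftrightarrow> f (i 0) x = 1"
      using x by (simp add: player_level_def j(2))
    then show "f v x = f (i 0) x"
      using funcset_mem[OF fS[OF v] x] funcset_mem[OF fS[OF \<open>i 0 \<in> S\<close>] x]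
      by auto
  qed
  ultimately show ?thesis
    unfolding simple_dictator_protocol_def by (intro exI[of _ "f (i 0)"] conjI)
qed

lemma max_success_n_eq:
  assumes "1 \<le> n"
  shows "max_success_n (path_verts k) (path_edges k) \<rho> n S = optimum"
proof -
  let ?d = "\<lambda>(v::nat) (x::nat \<Rightarrow> int). x 1"
  have d: "protocol n S ?d" "simple_dictator_protocol n S ?d"
    using dictator_first[OF assms] dictator_imp_balanced[OF assms]
    by (auto simp: protocol_def simple_dictator_protocol_def)
  show ?thesis
    unfolding max_success_n_def
  proof (rule cSup_eq_maximum)
    show "optimum \<in> success_prob (path_verts k) (path_edges k) \<rho> n S ` {f. protocol n S f}"
      using success_prob_dictator[OF assms d] d(1) by force
  qed (auto intro: success_prob_le_optimum[OF assms])
qed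

lemma max_success_eq: "max_success (path_verts k) (path_edges k) \<rho> S = optimum"
  unfolding max_success_def by (simp add: max_success_n_eq cong: SUP_cong_simp)

lemma optimal_iff_simple_dictator:
  assumes "0 < l" "1 \<le> n" "protocol n S f"
  shows "optimal_protocol (path_verts k) (path_edges k) \<rho> n S f
    \<longleftrightarrow> simple_dictator_protocol n S f"
  using assms success_prob_dictator[of n f] success_prob_eq_optimum_imp_dictator[of n f]
  by (auto simp: optimal_protocol_def max_success_n_eq)

end

lemma finite_nat_set_enumeration:
  fixes S :: "nat set"
  assumes "finite S" "S \<noteq> {}"
  obtains i where "strict_mono_on {0..card S - 1} i" "S = i ` {0..card S - 1}"
proof -
  have "bij_betw (enumerate S) {..<card S} S"
    using finite_bij_enumerate[OF assms(1)] .
  moreover have "strict_mono_on {..<card S} (enumerate S)"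
    by (intro strict_mono_onI) (auto intro: finite_enumerate_mono[OF _ assms(1)])
  moreover have "{..<card S} = {0..card S - 1}"
    using assms card_gt_0_iff[of S] by auto
  ultimately show ?thesis
    using that[of "enumerate S"] by (simp add: bij_betw_def)
qed

lemma nondictator_step_bound:
  assumes "0 < r" "r < 1" "half_set n A" "\<not> dictator_set n A"
  shows "step_bound n r A \<le> (1 + r) / 2 - (1 - r) / 4 * ((r - r\<^sup>2) / 4 ^ n)"
  unfolding step_bound_def using excess_lower_bound[OF assms] assms(2)
  by (intro diff_left_mono mult_left_mono) auto

text \<open>
  For a simple protocol all the sets of the walk coincide, so every one of the \<open>k\<close> steps enjoys the
  improved bound.
\<close>
lemma success_prob_nondictator_le:
  assumes \<rho>: "0 < \<rho>" "\<rho> < 1" and n: "1 \<le> n" and f: "balanced n f" "\<not> dictator n f"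
  shows "success_prob (path_verts k) (path_edges k) \<rho> n (path_verts k) (\<lambda>v. f)
    \<le> ((1 + \<rho>) / 2 - (1 - \<rho>) / 4 * ((\<rho> - \<rho>\<^sup>2) / 4 ^ n)) ^ k"
proof -
  interpret path_players \<rho> k k "path_verts k" "\<lambda>j. j"
    by standard (use \<rho> in \<open>auto simp: path_verts_def strict_mono_on_def\<close>)
  have P: "protocol n (path_verts k) (\<lambda>v. f)"
    using f by (simp add: protocol_def)
  let ?b = "(1 + \<rho>) / 2 - (1 - \<rho>) / 4 * ((\<rho> - \<rho>\<^sup>2) / 4 ^ n)"
  have r: "r j = \<rho>" for j
    by (simp add: r_def)
  have "avg n (restricted_walk n r (player_level (\<lambda>v. f) n b) k) \<le> (\<Prod>j<k. ?b) / 2"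
    if b: "b \<in> {-1, 1}" for b
  proof (rule avg_restricted_walk_le)
    have "\<not> dictator_set n {x \<in> cube n. f x = b}"
      using dictator_set_level_iff[OF _ b, of f n] f by (simp add: balanced_def)
    then have "step_bound n (r j) (player_level (\<lambda>v. f) n b j') \<le> ?b" for j j'
      unfolding r player_level_def by (intro nondictator_step_bound \<rho> half_set_level n f b)
    then show "step_bound n (r j) (player_level (\<lambda>v. f) n b j) \<le> ?b \<and>
        step_bound n (r j) (player_level (\<lambda>v. f) n b (Suc j)) \<le> ?b" for j
      by blast
  qed (use r_bounds half_set_player_level[OF n P b] in auto)
  from this[of 1] this[of "-1"] show ?thesis
    by (simp add: success_prob_eq[OF P])
qed

lemma success_prob_full_dictator:
  assumes \<rho>: "0 < \<rho>" "\<rho> < 1" and n: "1 \<le> n"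
  shows "success_prob (path_verts k) (path_edges k) \<rho> n (path_verts k) (\<lambda>v x. x 1) = ((1 + \<rho>) / 2) ^ k"
proof -
  interpret path_players \<rho> k k "path_verts k" "\<lambda>j. j"
    by standard (use \<rho> in \<open>auto simp: path_verts_def strict_mono_on_def\<close>)
  have "protocol n (path_verts k) (\<lambda>v x. x 1)" "simple_dictator_protocol n (path_verts k) (\<lambda>v x. x 1)"
    using dictator_first[OF n] dictator_imp_balanced[OF n]
    by (auto simp: protocol_def simple_dictator_protocol_def)
  from success_prob_dictator[OF n this] show ?thesis
    by (simp add: optimum_def r_def)
qed

theorem theorem5p1:
  fixes \<rho> :: real
  assumes "0 < \<rho>" and "\<rho> < 1"
  shows
    "(\<forall>k\<ge>1. \<forall>S \<subseteq> path_verts k. card S \<ge> 2 \<longrightarrow>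
       (\<forall>n\<ge>1. \<forall>f. protocol n S f \<longrightarrow>
          (optimal_protocol (path_verts k) (path_edges k) \<rho> n S f
             \<longleftrightarrow> simple_dictator_protocol n S f)) \<and>
       (\<forall>(l::nat) (i::nat \<Rightarrow> nat). strict_mono_on {0..l} i \<and> S = i ` {0..l} \<longrightarrow>
          max_success (path_verts k) (path_edges k) \<rho> S
            = (\<Prod>j=1..l. 1/2 + 1/2 * \<rho> ^ (i j - i (j - 1)))))
     \<and>
     (\<forall>n\<ge>1. \<exists>c<(1::real). \<forall>k\<ge>1. \<forall>f. balanced n f \<and> \<not> dictator n f \<longrightarrow>
       success_prob (path_verts k) (path_edges k) \<rho> n (path_verts k) (\<lambda>v. f)
         \<le> success_prob (path_verts k) (path_edges k) \<rho> n (path_verts k) (\<lambda>v x. x 1)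
             * c ^ (card (path_verts k) - 1))"
proof (rule conjI)
  show "\<forall>k\<ge>1. \<forall>S \<subseteq> path_verts k. card S \<ge> 2 \<longrightarrow>
       (\<forall>n\<ge>1. \<forall>f. protocol n S f \<longrightarrow>
          (optimal_protocol (path_verts k) (path_edges k) \<rho> n S f
             \<longleftrightarrow> simple_dictator_protocol n S f)) \<and>
       (\<forall>(l::nat) (i::nat \<Rightarrow> nat). strict_mono_on {0..l} i \<and> S = i ` {0..l} \<longrightarrow>
          max_success (path_verts k) (path_edges k) \<rho> S
            = (\<Prod>j=1..l. 1/2 + 1/2 * \<rho> ^ (i j - i (j - 1))))"
  proof (intro allI impI conjI)
    fix k n S f
    assume S: "S \<subseteq> path_verts k" "2 \<le> card S" and n: "1 \<le> n" and f: "protocol n S f"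
    have "finite S" "S \<noteq> {}"
      using S by (auto simp: path_verts_def intro: finite_subset)
    then obtain i where i: "strict_mono_on {0..card S - 1} i" "S = i ` {0..card S - 1}"
      by (rule finite_nat_set_enumeration)
    have "0 < card S - 1"
      using S(2) by simp
    interpret path_players \<rho> k "card S - 1" S i
      by standard (use assms S i in auto)
    show "optimal_protocol (path_verts k) (path_edges k) \<rho> n S f \<longleftrightarrow> simple_dictator_protocol n S f"
      by (rule optimal_iff_simple_dictator) fact+
  next
    fix k l :: nat and S and i :: "nat \<Rightarrow> nat"
    assume S: "S \<subseteq> path_verts k" and i: "strict_mono_on {0..l} i \<and> S = i ` {0..l}"
    interpret path_players \<rho> k l S i
      by standard (use assms S i in auto)
    show "max_success (path_verts k) (path_edges k) \<rho> S
        = (\<Prod>j=1..l. 1/2 + 1/2 * \<rho> ^ (i j - i (j - 1)))"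
      by (simp add: max_success_eq optimum_def r_def prod.atLeast1_atMost_eq add_divide_distrib)
  qed
next
  show "\<forall>n\<ge>1. \<exists>c<(1::real). \<forall>k\<ge>1. \<forall>f. balanced n f \<and> \<not> dictator n f \<longrightarrow>
       success_prob (path_verts k) (path_edges k) \<rho> n (path_verts k) (\<lambda>v. f)
         \<le> success_prob (path_verts k) (path_edges k) \<rho> n (path_verts k) (\<lambda>v x. x 1)
             * c ^ (card (path_verts k) - 1)"
  proof (intro allI impI)
    fix n :: nat assume n: "1 \<le> n"
    define b where "b = (1 + \<rho>) / 2 - (1 - \<rho>) / 4 * ((\<rho> - \<rho>\<^sup>2) / 4 ^ n)"
    \<comment> \<open>The ratio of the bounds per step for non-dictators and for dictators.\<close>
    define c where "c = b / ((1 + \<rho>) / 2)"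
    have "\<rho>\<^sup>2 < \<rho>"
      using assms by (simp add: power2_eq_square)
    then have "0 < (1 - \<rho>) / 4 * ((\<rho> - \<rho>\<^sup>2) / 4 ^ n)"
      using assms by (intro mult_pos_pos divide_pos_pos) auto
    then have "b < (1 + \<rho>) / 2"
      unfolding b_def by linarith
    then have "c < 1"
      using assms by (simp add: c_def)
    moreover have "success_prob (path_verts k) (path_edges k) \<rho> n (path_verts k) (\<lambda>v. f)
         \<le> success_prob (path_verts k) (path_edges k) \<rho> n (path_verts k) (\<lambda>v x. x 1)
             * c ^ (card (path_verts k) - 1)"
      if "balanced n f \<and> \<not> dictator n f" for k f
    proof -
      have "success_prob (path_verts k) (path_edges k) \<rho> n (path_verts k) (\<lambda>v. f) \<le> b ^ k"
        unfolding b_def using success_prob_nondictator_le[OF assms n] that by blast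
      also have "b = (1 + \<rho>) / 2 * c"
        using assms by (simp add: c_def)
      finally show ?thesis
        unfolding success_prob_full_dictator[OF assms n] power_mult_distrib
        by (simp add: path_verts_def)
    qed
    ultimately show "\<exists>c<(1::real). \<forall>k\<ge>1. \<forall>f. balanced n f \<and> \<not> dictator n f \<longrightarrow>
       success_prob (path_verts k) (path_edges k) \<rho> n (path_verts k) (\<lambda>v. f)
         \<le> success_prob (path_verts k) (path_edges k) \<rho> n (path_verts k) (\<lambda>v x. x 1)
             * c ^ (card (path_verts k) - 1)"
      by blast
  qed
qed

end
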